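(* Let $f(n,k)$ be the number of web permutations $\sigma$ of $[n]=\{1,\dots,n\}$ with $M(\sigma)=M_0^{(n)}$ and $\sigma_1=k$, and let $(s_{i,j})$ be the Seidel triangle. Then $$f(2n-1,2k-1)=s_{2n-2,k}\qquad\text{for all } n\ge 2,\ 1\le k\le n,$$ and $$f(2n,2k-1)=s_{2n-1,\,n-k+1}\qquad\text{for all } n\ge 1,\ 1\le k\le n.$$
   Context: Seidel triangle: the array $(s_{i,j})_{i\ge 1}$ determined by $s_{1,1}=s_{2,1}=1$, $s_{i,j}=0$ if $j=0$ or $j>\lceil i/2\rceil$, $s_{2i+1,j}=s_{2i+1,j-1}+s_{2i,j}$ for $j=1,\dots,i+1$ ($i\geq 1$), and $s_{2i,j}=s_{2i,j+1}+s_{2i-1,j}$ for $j=1,\dots,i$ ($i\ge 1$). Let $\mathfrak{S}_n$ be the set of permutations $\sigma=\sigma_1\cdots\sigma_n$ of $[n]$. In an $n\times n$ cell chart, cell $(i,j)$ is the cell in column $i$ (from the left) and row $j$ (from the bottom). Crossings: for $\sigma\in\mathfrak{S}_n$, cell $(i,j)$ is a crossing of $\sigma$ if $i<\sigma^{-1}_j$ and $j>\sigma_i$, where $\sigma^{-1}_j$ is the position of the letter $j$ in $\sigma$. Let $\mathrm{Cr}(\sigma)$ be the set of crossings of $\sigma$. (Pictorially: place a mark in each cell $(i,\sigma_i)$ and draw from it a straight line left and a straight line up to the boundary; the crossings are the cells with both a horizontal and a vertical line passing through.) For $E\subseteq\mathrm{Cr}(\sigma)$ the grid configuration $G(\sigma,E)$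 is obtained by replacing each crossing in $E$ by an elbow, i.e. by two disjoint arcs, one joining the left side of the cell to its bottom side and one joining its right side to its top side. The crossings of $G(\sigma,E)$ are the elements of $\mathrm{Cr}(\sigma)\setminus E$. Order cells by $(i,j)\succeq(i',j')$ iff $i\le i'$ and $j\ge j'$. Resolving a maximal crossing $c=(i,j)$ of $G(\sigma,E)$: smoothing replaces $G(\sigma,E)$ by $G(\sigma,E\cup\{c\})$; switching replaces $G(\sigma,E)$ by $G(\sigma\cdot t_{i,\ell},E)$, where $\ell=\sigma^{-1}_j$ and $\sigma\cdot t_{i,\ell}$ is obtained from $\sigma$ by exchanging the letters in positions $i$ and $\ell$. Web permutations: start from $G(id_n,\emptyset)$, where $id_n$ is the identity. Repeatedly, in each configuration having a crossing, choose a maximal crossing and replace the configuration by the two configurations obtained by smoothing and by switching it, until no configuration has a crossing. The final configurations have the form $G(\sigma,\mathrm{Cr}(\sigma))$; the permutations $\sigma$ that occur are the web permutations of $[n]$. (It is known that the result does not depend on the choices of maximal crossings and that all resulting permutations are distinct.) Matching $M(\sigma)$: in $G(\sigma,\mathrm{Cr}(\sigma))$, the cell $(i,\sigma_i)$ contains an arc joining its left and top sides; each crossing cell contains an elbow, i.e. two disjoint arcs, one joining the left side of the cell to its bottom side and one joining its right side to its top side; a non-crossing cell $(i,j)$ with $i<\sigma^{-1}_j$ and $j<\sigma_i$ contains a horizontal segment; a non-crossing cell with $j>\sigma_i$ and $i>\sigma^{-1}_j$ contains a vertical segment; other cells are empty. Label the $n$ unit segments of the left boundary $0,1,\dots,n-1$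 from bottom to top and the $n$ unit segments of the top boundary $n,n+1,\dots,2n-1$ from left to right. The $n$ resulting arcs join these labels in pairs; $M(\sigma)$ is this perfect matching of $\{0,1,\dots,2n-1\}$. $M_0^{(n)}=\{\{0,1\},\{2,3\},\dots,\{2n-2,2n-1\}\}$. *)

theory Defs
  imports "HOL-Combinatorics.Permutations"
begin

section \<open>The Seidel triangle\<close>

function seidel :: "nat \<Rightarrow> nat \<Rightarrow> nat" where
  "seidel i j =
    (if i = 0 \<or> j = 0 \<or> j > (i + 1) div 2 then 0
     else if i \<le> 2 then 1
     else if odd i then seidel i (j - 1) + seidel (i - 1) j
     else seidel i (j + 1) + seidel (i - 1) j)"
  by auto
text \<open>Odd rows are filled from left to right, even rows from right to left.\<close>
termination
  by (relation "measures [\<lambda>(i, j). i, \<lambda>(i, j). if odd i then j else i - j]") auto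

declare seidel.simps [simp del]

lemma seidel_1_1: "seidel 1 1 = 1"
  by (subst seidel.simps) simp

lemma seidel_2_1: "seidel 2 1 = 1"
  by (subst seidel.simps) simp

lemma seidel_outside:
  assumes "j = 0 \<or> j > (i + 1) div 2"
  shows "seidel i j = 0"
  using assms by (subst seidel.simps) auto

lemma seidel_odd:
  assumes "i \<ge> 1" "1 \<le> j" "j \<le> i + 1"
  shows "seidel (2 * i + 1) j = seidel (2 * i + 1) (j - 1) + seidel (2 * i) j"
  using assms by (subst seidel.simps) auto

lemma seidel_even:
  assumes "i \<ge> 1" "1 \<le> j" "j \<le> i"
  shows "seidel (2 * i) j = seidel (2 * i) (j + 1) + seidel (2 * i - 1) j"
proof (cases "i = 1")
  case True
  with assms have "j = 1" by simp
  moreover have "seidel 2 2 = 0" by (rule seidel_outside) simp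
  ultimately show ?thesis
    using True seidel_1_1 seidel_2_1 by (simp add: numeral_2_eq_2)
next
  case False
  with assms show ?thesis by (subst seidel.simps) auto
qed


section \<open>Grid configurations and web permutations\<close>

text \<open>
  A permutation of \<open>[n]\<close> is a function \<open>\<sigma>\<close> with \<open>\<sigma> permutes {1..n}\<close>; the letter in position \<open>i\<close>
  is \<open>\<sigma> i\<close>, and \<open>inv \<sigma> j\<close> is the position of the letter \<open>j\<close>.  A cell \<open>(i, j)\<close> lies in column \<open>i\<close>
  (from the left) and row \<open>j\<close> (from the bottom).
\<close>

type_synonym cell = "nat \<times> nat"

definition Cr :: "nat \<Rightarrow> (nat \<Rightarrow> nat) \<Rightarrow> cell set" where
  "Cr n \<sigma> = {(i, j). i \<in> {1..n} \<and> j \<in> {1..n} \<and> i < inv \<sigma> j \<and> j > \<sigma> i}"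

text \<open>The pair \<open>(\<sigma>, E)\<close> represents the grid configuration \<open>G(\<sigma>, E)\<close>.\<close>

type_synonym grid_config = "(nat \<Rightarrow> nat) \<times> cell set"

definition config_crossings :: "nat \<Rightarrow> grid_config \<Rightarrow> cell set" where
  "config_crossings n G = Cr n (fst G) - snd G"

definition cell_succeq :: "cell \<Rightarrow> cell \<Rightarrow> bool" where
  "cell_succeq c d \<longleftrightarrow> fst c \<le> fst d \<and> snd c \<ge> snd d"

definition maximal_crossing :: "nat \<Rightarrow> grid_config \<Rightarrow> cell \<Rightarrow> bool" where
  "maximal_crossing n G c \<longleftrightarrow>
     c \<in> config_crossings n G \<and>
     (\<forall>d \<in> config_crossings n G. cell_succeq d c \<longrightarrow> d = c)"

inductive resolve :: "nat \<Rightarrow> grid_config \<Rightarrow> grid_config \<Rightarrow> bool" for n :: nat where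
  smooth: "maximal_crossing n (\<sigma>, E) c \<Longrightarrow> resolve n (\<sigma>, E) (\<sigma>, insert c E)"
| switch: "maximal_crossing n (\<sigma>, E) (i, j) \<Longrightarrow>
     resolve n (\<sigma>, E) (\<sigma> \<circ> Transposition.transpose i (inv \<sigma> j), E)"

text \<open>
  Every choice of maximal crossings is allowed along the way; the outcome of the resolution
  process is independent of these choices.
\<close>

definition web_permutation :: "nat \<Rightarrow> (nat \<Rightarrow> nat) \<Rightarrow> bool" where
  "web_permutation n \<sigma> \<longleftrightarrow>
     (\<exists>E. (resolve n)\<^sup>*\<^sup>* (id, {}) (\<sigma>, E) \<and> config_crossings n (\<sigma>, E) = {})"


section \<open>The matching of a permutation\<close>

text \<open>
  Unit segments of the grid: \<open>VSeg i j\<close> is the right side of cell \<open>(i, j)\<close>, which is also the left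
  side of cell \<open>(i + 1, j)\<close>; \<open>HSeg i j\<close> is the top side of cell \<open>(i, j)\<close>, which is also the bottom
  side of cell \<open>(i, j + 1)\<close>.
\<close>

datatype segment = VSeg nat nat | HSeg nat nat

abbreviation left_side :: "cell \<Rightarrow> segment" where
  "left_side c \<equiv> VSeg (fst c - 1) (snd c)"

abbreviation right_side :: "cell \<Rightarrow> segment" where
  "right_side c \<equiv> VSeg (fst c) (snd c)"

abbreviation bottom_side :: "cell \<Rightarrow> segment" where
  "bottom_side c \<equiv> HSeg (fst c) (snd c - 1)"

abbreviation top_side :: "cell \<Rightarrow> segment" where
  "top_side c \<equiv> HSeg (fst c) (snd c)"

text \<open>The sides joined inside a single cell of \<open>G(\<sigma>, Cr(\<sigma>))\<close>.\<close>

inductive cell_arc :: "nat \<Rightarrow> (nat \<Rightarrow> nat) \<Rightarrow> segment \<Rightarrow> segment \<Rightarrow> bool"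
  for n :: nat and \<sigma> :: "nat \<Rightarrow> nat" where
  mark: "i \<in> {1..n} \<Longrightarrow> cell_arc n \<sigma> (left_side (i, \<sigma> i)) (top_side (i, \<sigma> i))"
| elbow_left_bottom: "c \<in> Cr n \<sigma> \<Longrightarrow> cell_arc n \<sigma> (left_side c) (bottom_side c)"
| elbow_right_top: "c \<in> Cr n \<sigma> \<Longrightarrow> cell_arc n \<sigma> (right_side c) (top_side c)"
| horizontal: "i \<in> {1..n} \<Longrightarrow> j \<in> {1..n} \<Longrightarrow> i < inv \<sigma> j \<Longrightarrow> j < \<sigma> i \<Longrightarrow>
     cell_arc n \<sigma> (left_side (i, j)) (right_side (i, j))"
| vertical: "i \<in> {1..n} \<Longrightarrow> j \<in> {1..n} \<Longrightarrow> j > \<sigma> i \<Longrightarrow> i > inv \<sigma> j \<Longrightarrow>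
     cell_arc n \<sigma> (bottom_side (i, j)) (top_side (i, j))"

definition boundary_segment :: "nat \<Rightarrow> nat \<Rightarrow> segment" where
  "boundary_segment n a = (if a < n then VSeg 0 (a + 1) else HSeg (a - n + 1) n)"

definition matching :: "nat \<Rightarrow> (nat \<Rightarrow> nat) \<Rightarrow> nat set set" where
  "matching n \<sigma> =
     {{a, b} | a b. a < 2 * n \<and> b < 2 * n \<and> a \<noteq> b \<and>
        (symclp (cell_arc n \<sigma>))\<^sup>*\<^sup>* (boundary_segment n a) (boundary_segment n b)}"

definition matching0 :: "nat \<Rightarrow> nat set set" where
  "matching0 n = {{2 * i, 2 * i + 1} | i. i < n}"

definition web_count :: "nat \<Rightarrow> nat \<Rightarrow> nat" where
  "web_count n k =
     card {\<sigma>. web_permutation n \<sigma> \<and> matching n \<sigma> = matching0 n \<and> \<sigma> 1 = k}"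

end

theory Submission
  imports Defs
begin

text \<open>
  Resolving two different maximal crossings commutes, so the crossings may be resolved column by
  column, each column from top to bottom.  For one column this amounts to exchanging the first
  remaining letter \<open>a\<close> with some remaining letter \<open>j \<ge> a\<close> (lemma
  \<open>web_permutation_iff_column_process\<close>).  In the first column, the curves of
  \<open>G(\<sigma>, Cr(\<sigma>))\<close> join rows \<open>\<sigma> 1\<close> and \<open>\<sigma> 1 + 1\<close> (or row \<open>n\<close> and the first top segment, if
  \<open>\<sigma> 1 = n\<close>) and carry all other boundary segments in order to the boundary of the remaining
  grid.  Hence \<open>M(\<sigma>)\<close> arises from the matching of the remaining grid by inserting one arc
  between neighbours, and \<open>M(\<sigma>)\<close> is \<open>M\<^sub>0\<close> exactly if all entries of the Lehmer
  code of \<open>\<sigma>\<close> are even (lemma \<open>matching0_iff_even_lehmer\<close>).  The problem is now to count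
  the outcomes of the column process with even Lehmer code.

  This count is the coefficient of \<open>M\<^sub>0\<close> when the matching of a permutation diagram (rows
  joined to columns by straight lines) is expanded into noncrossing matchings by the Ptolemy
  relation \<open>ac * bd = ab * cd + ad * bc\<close>.  The coefficient is realised as a function on all
  matchings, crossing or not, without using a basis.  Assign to a chord with end points
  \<open>p < q\<close> the polynomial \<open>x\<^sub>q - x\<^sub>p\<close>; these polynomials satisfy the
  Ptolemy relation.  Expand the product over all chords into monomials, which are binary words, and
  evaluate each word by a weight \<open>w\<close> with
  \<open>w(A01B) - w(A10B) = w(AB)\<close> if \<open>A\<close> has even length, and \<open>= 0\<close> otherwise.  Such a weight
  exists because two descents \<open>10\<close> of a word never overlap (lemma \<open>word_weight_descent\<close>).
  The resulting weight of a matching is that of the remaining matching times 1 or 0 when an arc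
  between neighbours at an even or odd position is removed (lemma \<open>matching_weight_arc\<close>), and
  it changes by such a reduction when two neighbouring end points are exchanged (lemma
  \<open>matching_weight_exchange\<close>).  Therefore it satisfies the recursion of the column process
  (lemma \<open>diagram_weight_Cons\<close>).

  After the first column has been resolved with letter \<open>k\<close>, the diagram consists of parallel chords and
  one more chord from the lowest row to a column depending on \<open>k\<close>.  Let \<open>g(M, L)\<close> be the
  weight of \<open>M\<close> parallel chords together with a chord that starts at the first point and spans
  \<open>L\<close> of their end points.  Moving the end of this chord by one step gives
  \<open>g(M, L + 1) = g(M, L)\<close> for even \<open>L\<close>, and for odd \<open>L\<close> a difference
  \<open>g(M - 1, L + M - 1)\<close> if \<open>L < M\<close> and \<open>- g(M - 1, L - M)\<close> if \<open>L \<ge> M\<close>.  These are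
  precisely the two rules of the Seidel triangle (lemma \<open>seidel_rows\<close>).  For grids of odd size
  the web counts are directly the values found there; for grids of even size and first letter
  greater than 1 they are values \<open>g(M, L)\<close> with \<open>L > M\<close>, which equal those with \<open>L < M\<close> by the symmetry
  \<open>g(M, L) = g(M, 2 * M - L)\<close> for odd \<open>L\<close> (lemma \<open>chord_weight_symmetric\<close>).
\<close>

section \<open>Resolving crossings in any order\<close>

definition switched :: "(nat \<Rightarrow> nat) \<Rightarrow> cell \<Rightarrow> nat \<Rightarrow> nat" where
  "switched \<sigma> c = \<sigma> \<circ> Transposition.transpose (fst c) (inv \<sigma> (snd c))"

definition resolves_at :: "cell \<Rightarrow> grid_config \<Rightarrow> grid_config \<Rightarrow> bool" where
  "resolves_at c G H \<longleftrightarrow> H = (fst G, insert c (snd G)) \<or> H = (switched (fst G) c, snd G)"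

lemma resolve_iff:
  "resolve n G H \<longleftrightarrow> (\<exists>c. maximal_crossing n G c \<and> resolves_at c G H)"
  by (cases G) (auto simp: resolve.simps resolves_at_def switched_def)

lemma resolveI:
  assumes "maximal_crossing n (\<sigma>, E) c"
  shows "resolve n (\<sigma>, E) (\<sigma>, insert c E)" "resolve n (\<sigma>, E) (switched \<sigma> c, E)"
  unfolding resolve_iff using assms by (intro exI[of _ c] conjI assms; simp add: resolves_at_def)+

lemma inv_comp_transpose:
  assumes "\<sigma> permutes S"
  shows "inv (\<sigma> \<circ> Transposition.transpose a b) y = Transposition.transpose a b (inv \<sigma> y)"
  using assms by (simp add: permutes_bij bij_is_inj o_inv_distrib)

lemma in_CrD:
  assumes "(i, j) \<in> Cr n \<sigma>" "\<sigma> permutes {1..n}"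
  shows "i \<in> {1..n}" "j \<in> {1..n}" "i < inv \<sigma> j" "\<sigma> i < j" "inv \<sigma> j \<in> {1..n}" "\<sigma> (inv \<sigma> j) = j"
  using assms permutes_in_image[OF permutes_inv[OF assms(2)]]
  by (auto simp: Cr_def permutes_inverses(1))

lemma switched_permutes:
  assumes "\<sigma> permutes {1..n}" "c \<in> Cr n \<sigma>"
  shows "switched \<sigma> c permutes {1..n}"
  unfolding switched_def using in_CrD[of "fst c" "snd c" n \<sigma>] assms
  by (intro permutes_compose[OF permutes_swap_id]) auto

lemma maximal_crossing_in_Cr: "maximal_crossing n G c \<Longrightarrow> c \<in> Cr n (fst G)"
  by (simp add: maximal_crossing_def config_crossings_def)

lemma maximal_crossings_differ:
  assumes "maximal_crossing n G c" "maximal_crossing n G c'" "c \<noteq> c'"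
  shows "fst c \<noteq> fst c'" "snd c \<noteq> snd c'" "\<not> cell_succeq c c'"
  using assms unfolding maximal_crossing_def cell_succeq_def
  by (metis linorder_le_cases order_refl)+

text \<open>
  If the two transpositions share a position, then, up to exchanging the two crossings, \<open>\<sigma>\<close> has letters \<open>a < j < j'\<close> at positions
  \<open>i < i' < l'\<close> and either order of switching produces the cyclic rearrangement \<open>j, j', a\<close>.
\<close>

lemma switched_commute:
  assumes p: "\<sigma> permutes {1..n}"
    and c: "maximal_crossing n (\<sigma>, E) c" and c': "maximal_crossing n (\<sigma>, E) c'" and ne: "c \<noteq> c'"
  shows "switched (switched \<sigma> c) c' = switched (switched \<sigma> c') c"
proof -
  obtain i j i' j' where ij: "c = (i, j)" "c' = (i', j')" by force
  note d = maximal_crossings_differ[OF c c' ne]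
  define l l' where "l = inv \<sigma> j" and "l' = inv \<sigma> j'"
  have "i < l" "i' < l'" "l \<noteq> l'"
    using in_CrD[OF _ p, of i j] in_CrD[OF _ p, of i' j'] c c' d(2) ij
    by (auto simp: l_def l'_def dest!: maximal_crossing_in_Cr)
  moreover have "i \<noteq> i'" using d ij by simp
  ultimately have "Transposition.transpose i l \<circ> Transposition.transpose i' (Transposition.transpose i l l') =
     Transposition.transpose i' l' \<circ> Transposition.transpose i (Transposition.transpose i' l' l)"
    by (auto simp: fun_eq_iff transpose_def)
  then show ?thesis
    unfolding switched_def ij
    by (simp add: inv_comp_transpose[OF p] comp_assoc flip: l_def l'_def)
qed

lemma maximal_after_smoothing:
  assumes "maximal_crossing n (\<sigma>, E) c'" "c \<noteq> c'"
  shows "maximal_crossing n (\<sigma>, insert c E) c'"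
  using assms by (auto simp: maximal_crossing_def config_crossings_def)

text \<open>
  Switching \<open>(i, j)\<close> can create crossings, but only in the column of \<open>j\<close> and the row of
  \<open>\<sigma> i\<close>, below and to the right of \<open>(i, j)\<close>.  A new crossing above and to the left of \<open>c'\<close>
  would make \<open>(i, j)\<close> comparable with \<open>c'\<close>.
\<close>

lemma maximal_after_switching:
  assumes p: "\<sigma> permutes {1..n}"
    and c: "maximal_crossing n (\<sigma>, E) c" and c': "maximal_crossing n (\<sigma>, E) c'" and ne: "c \<noteq> c'"
  shows "maximal_crossing n (switched \<sigma> c, E) c'"
proof -
  obtain i j i' j' where ij: "c = (i, j)" "c' = (i', j')" by force
  have d: "i \<noteq> i'" "j \<noteq> j'" "\<not> (i \<le> i' \<and> j \<ge> j')"
    using maximal_crossings_differ[OF c c' ne] by (auto simp: ij cell_succeq_def)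
  define l where "l = inv \<sigma> j"
  define \<sigma>' where "\<sigma>' = switched \<sigma> c"
  have cr: "(i, j) \<in> Cr n \<sigma>" "(i', j') \<in> Cr n \<sigma>" "(i', j') \<notin> E"
    using c c' by (auto simp: ij maximal_crossing_def config_crossings_def)
  note C = in_CrD[OF cr(1) p, folded l_def] and C' = in_CrD[OF cr(2) p]
  have s: "\<sigma>' x = (if x = i then j else if x = l then \<sigma> i else \<sigma> x)" for x
    using C by (simp add: \<sigma>'_def switched_def ij transpose_def flip: l_def)
  have inv: "inv \<sigma>' y = (if y = j then i else if y = \<sigma> i then l else inv \<sigma> y)" for y
  proof -
    have "inv \<sigma> y = i \<longleftrightarrow> y = \<sigma> i" "inv \<sigma> y = l \<longleftrightarrow> y = j"
      using p C by (auto simp: l_def permutes_inv_eq)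
    then show ?thesis
      unfolding \<sigma>'_def switched_def ij inv_comp_transpose[OF p]
      using C by (auto simp: transpose_def simp flip: l_def)
  qed
  have "(i', j') \<in> Cr n \<sigma>'"
    using C C' d by (auto simp: Cr_def s inv)
  moreover have "(x, y) = (i', j')"
    if xy: "(x, y) \<in> Cr n \<sigma>'" "(x, y) \<notin> E" "x \<le> i'" "y \<ge> j'" for x y
  proof -
    have r: "x \<in> {1..n}" "y \<in> {1..n}" "x < inv \<sigma>' y" "\<sigma>' x < y"
      using xy(1) by (auto simp: Cr_def)
    have "(x, y) \<in> Cr n \<sigma>"
    proof -
      have "x < inv \<sigma> y" using r C d xy(3,4) p
        by (auto simp: s inv permutes_inverses(2) split: if_splits)
      moreover have "\<sigma> x < y" using r C d xy(3,4) p
        by (auto simp: s inv permutes_inverses(2) split: if_splits)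
      ultimately show ?thesis using r by (simp add: Cr_def)
    qed
    then show ?thesis
      using c' xy(2-4) by (auto simp: ij maximal_crossing_def config_crossings_def cell_succeq_def)
  qed
  ultimately show ?thesis
    using cr(3) unfolding maximal_crossing_def config_crossings_def cell_succeq_def ij \<sigma>'_def[unfolded ij, symmetric]
    by auto
qed

lemma resolves_at_commute:
  assumes p: "fst G permutes {1..n}"
    and c: "maximal_crossing n G c" and c': "maximal_crossing n G c'" and ne: "c \<noteq> c'"
    and H: "resolves_at c G H" and K: "resolves_at c' H K"
  obtains H' where "resolves_at c' G H'" "resolve n H' K"
proof -
  obtain \<sigma> E where G: "G = (\<sigma>, E)" by force
  have m: "maximal_crossing n (\<sigma>, insert c' E) c" "maximal_crossing n (switched \<sigma> c', E) c"
    using maximal_after_smoothing[of n \<sigma> E c c'] maximal_after_switching[of \<sigma> n E c' c] assms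
    by (auto simp: G)
  have sc: "switched (switched \<sigma> c) c' = switched (switched \<sigma> c') c"
    using switched_commute[of \<sigma> n E c c'] assms by (auto simp: G)
  have "K = (\<sigma>, insert c (insert c' E)) \<or> K = (switched \<sigma> c', insert c E) \<or>
     K = (switched \<sigma> c, insert c' E) \<or> K = (switched (switched \<sigma> c') c, E)"
  proof -
    have "H = (\<sigma>, insert c E) \<or> H = (switched \<sigma> c, E)"
      using H by (simp add: resolves_at_def G)
    moreover have "K = (fst H, insert c' (snd H)) \<or> K = (switched (fst H) c', snd H)"
      using K by (simp add: resolves_at_def)
    ultimately show ?thesis
      using sc insert_commute[of c c' E] by (elim disjE) simp_all
  qed
  then consider "K = (\<sigma>, insert c (insert c' E))" | "K = (switched \<sigma> c', insert c E)"
    | "K = (switched \<sigma> c, insert c' E)" | "K = (switched (switched \<sigma> c') c, E)"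
    by blast
  then show thesis
  proof cases
    case 1
    then show ?thesis
      using that[of "(\<sigma>, insert c' E)"] resolveI(1)[OF m(1)] by (simp add: G resolves_at_def)
  next
    case 2
    then show ?thesis
      using that[of "(switched \<sigma> c', E)"] resolveI(1)[OF m(2)] by (simp add: G resolves_at_def)
  next
    case 3
    then show ?thesis
      using that[of "(\<sigma>, insert c' E)"] resolveI(2)[OF m(1)] by (simp add: G resolves_at_def)
  next
    case 4
    then show ?thesis
      using that[of "(switched \<sigma> c', E)"] resolveI(2)[OF m(2)] by (simp add: G resolves_at_def)
  qed
qed

lemma resolves_at_permutes:
  assumes "fst G permutes {1..n}" "maximal_crossing n G c" "resolves_at c G H"
  shows "fst H permutes {1..n}"
  using assms(1,3) switched_permutes[OF assms(1) maximal_crossing_in_Cr[OF assms(2)]]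
  by (auto simp: resolves_at_def)

lemma maximal_after_other:
  assumes "fst G permutes {1..n}" "maximal_crossing n G c" "maximal_crossing n G c'" "c \<noteq> c'"
    "resolves_at c G H"
  shows "maximal_crossing n H c'"
proof -
  obtain \<sigma> E where "G = (\<sigma>, E)" by force
  then show ?thesis
    using assms maximal_after_smoothing[of n \<sigma> E c' c] maximal_after_switching[of \<sigma> n E c c']
    by (auto simp: resolves_at_def)
qed

text \<open>
  The independence of choices in the form needed here: every complete resolution can be reordered, in
  the same number of steps, so that it begins at a prescribed maximal crossing.
\<close>

lemma any_maximal_crossing_first:
  assumes "(resolve n ^^ Suc m) G F" "config_crossings n F = {}" "fst G permutes {1..n}"
    and "maximal_crossing n G c'"
  shows "\<exists>K. resolves_at c' G K \<and> (resolve n ^^ m) K F"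
  using assms
proof (induction m arbitrary: G)
  case 0
  then obtain c where c: "maximal_crossing n G c" "resolves_at c G F" by (auto simp: resolve_iff)
  have "c = c'"
  proof (rule ccontr)
    assume "c \<noteq> c'"
    then have "maximal_crossing n F c'" using maximal_after_other[OF 0(3) c(1) 0(4)] c by blast
    then show False using 0(2) by (simp add: maximal_crossing_def)
  qed
  then show ?case using c by (intro exI[of _ F]) simp
next
  case (Suc m)
  obtain H where H: "resolve n G H" "(resolve n ^^ Suc m) H F"
    using Suc.prems(1) relpowp_Suc_D2 by metis
  obtain c where c: "maximal_crossing n G c" "resolves_at c G H" using H by (auto simp: resolve_iff)
  show ?case
  proof (cases "c = c'")
    case True
    then show ?thesis using c H by blast
  next
    case False
    have "maximal_crossing n H c'" "fst H permutes {1..n}"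
      using maximal_after_other[OF Suc.prems(3) c(1) Suc.prems(4) False c(2)]
        resolves_at_permutes[OF Suc.prems(3) c] by auto
    then obtain K where K: "resolves_at c' H K" "(resolve n ^^ m) K F"
      using Suc.IH H(2) Suc.prems(2) by blast
    obtain H' where "resolves_at c' G H'" "resolve n H' K"
      using resolves_at_commute[OF Suc.prems(3) c(1) Suc.prems(4) False c(2) K(1)] .
    then show ?thesis using K(2) relpowp_Suc_I2 by metis
  qed
qed

definition outcome :: "nat \<Rightarrow> grid_config \<Rightarrow> (nat \<Rightarrow> nat) \<Rightarrow> bool" where
  "outcome n G \<tau> \<longleftrightarrow> (\<exists>E. (resolve n)\<^sup>*\<^sup>* G (\<tau>, E) \<and> config_crossings n (\<tau>, E) = {})"

lemma outcome_step:
  assumes "resolve n G H" "outcome n H \<tau>"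
  shows "outcome n G \<tau>"
  using assms converse_rtranclp_into_rtranclp[of "resolve n" G H] unfolding outcome_def by blast

lemma outcome_maximal:
  assumes "\<sigma> permutes {1..n}" "maximal_crossing n (\<sigma>, E) c"
  shows "outcome n (\<sigma>, E) \<tau> \<longleftrightarrow> outcome n (\<sigma>, insert c E) \<tau> \<or> outcome n (switched \<sigma> c, E) \<tau>"
proof
  assume "outcome n (\<sigma>, E) \<tau>"
  then obtain E' m where F: "(resolve n ^^ m) (\<sigma>, E) (\<tau>, E')" "config_crossings n (\<tau>, E') = {}"
    unfolding outcome_def by (auto simp: rtranclp_power)
  have "m \<noteq> 0" using F assms(2) by (intro notI) (auto simp: maximal_crossing_def)
  then obtain k where k: "m = Suc k" by (cases m) auto
  obtain K where "resolves_at c (\<sigma>, E) K" "(resolve n ^^ k) K (\<tau>, E')"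
    using any_maximal_crossing_first[OF F(1)[unfolded k] F(2) _ assms(2), unfolded fst_conv, OF assms(1)]
    by blast
  then have "(resolve n)\<^sup>*\<^sup>* K (\<tau>, E')" "resolves_at c (\<sigma>, E) K"
    by (auto simp: rtranclp_power)
  then show "outcome n (\<sigma>, insert c E) \<tau> \<or> outcome n (switched \<sigma> c, E) \<tau>"
    using F(2) by (auto simp: outcome_def resolves_at_def)
next
  note resolveI[OF assms(2)]
  moreover assume "outcome n (\<sigma>, insert c E) \<tau> \<or> outcome n (switched \<sigma> c, E) \<tau>"
  ultimately show "outcome n (\<sigma>, E) \<tau>"
    using outcome_step[of n "(\<sigma>, E)"] by (elim disjE)
qed

lemma outcome_final:
  assumes "config_crossings n (\<sigma>, E) = {}"
  shows "outcome n (\<sigma>, E) \<tau> \<longleftrightarrow> \<tau> = \<sigma>"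
proof -
  have no: "\<not> resolve n (\<sigma>, E) H" for H
    using assms unfolding resolve_iff maximal_crossing_def by blast
  have "H = (\<sigma>, E)" if "(resolve n)\<^sup>*\<^sup>* (\<sigma>, E) H" for H
    using that no by (cases rule: converse_rtranclpE) blast+
  then show ?thesis using assms unfolding outcome_def by blast
qed

text \<open>
  All crossings in column \<open>t\<close> and further right are resolved, one column at a time.  The choice
  \<open>l = t\<close> stands for smoothing the whole column; \<open>l > t\<close> stands for smoothing down to the
  row of the letter at position \<open>l\<close> and switching there, after which the column has no further
  unresolved crossing.
\<close>

inductive column_process :: "nat \<Rightarrow> nat \<Rightarrow> (nat \<Rightarrow> nat) \<Rightarrow> (nat \<Rightarrow> nat) \<Rightarrow> bool" for n :: nat where
  column_process_done: "column_process n (Suc n) \<sigma> \<sigma>"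
| column_process_step: "t \<le> l \<Longrightarrow> l \<le> n \<Longrightarrow> \<sigma> t \<le> \<sigma> l \<Longrightarrow>
     column_process n (Suc t) (\<sigma> \<circ> Transposition.transpose t l) \<tau> \<Longrightarrow> column_process n t \<sigma> \<tau>"

lemma column_process_Suc_iff: "column_process n (Suc n) \<sigma> \<tau> \<longleftrightarrow> \<tau> = \<sigma>"
  by (subst column_process.simps) auto

lemma column_process_iff:
  "t \<le> n \<Longrightarrow> column_process n t \<sigma> \<tau> \<longleftrightarrow>
    (\<exists>l. t \<le> l \<and> l \<le> n \<and> \<sigma> t \<le> \<sigma> l \<and> column_process n (Suc t) (\<sigma> \<circ> Transposition.transpose t l) \<tau>)"
  by (subst column_process.simps) auto

text \<open>
  The induction is on the number of unresolved crossings in column \<open>t\<close>.  The topmost one is a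
  maximal crossing: smoothing it leaves one fewer, and switching it finishes the column because all
  crossings above the new mark are already smoothed.
\<close>

lemma outcome_column:
  assumes later: "\<And>\<sigma> E. \<sigma> permutes {1..n} \<Longrightarrow> config_crossings n (\<sigma>, E) \<subseteq> {t<..} \<times> UNIV \<Longrightarrow>
      E \<subseteq> {..t} \<times> UNIV \<Longrightarrow> outcome n (\<sigma>, E) \<tau> \<longleftrightarrow> column_process n (Suc t) \<sigma> \<tau>"
    and p: "\<sigma> permutes {1..n}" and cc: "config_crossings n (\<sigma>, E) \<subseteq> {t..} \<times> UNIV"
    and E: "E \<subseteq> {..t} \<times> UNIV" and U: "U = {y. (t, y) \<in> config_crossings n (\<sigma>, E)}"
  shows "outcome n (\<sigma>, E) \<tau> \<longleftrightarrow>
    (\<exists>l. (l = t \<or> \<sigma> l \<in> U) \<and> column_process n (Suc t) (\<sigma> \<circ> Transposition.transpose t l) \<tau>)"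
  using cc E U
proof (induction "card U" arbitrary: U E)
  case (0 U E)
  have "finite U" unfolding 0(4) by (rule finite_subset[of _ "{1..n}"]) (auto simp: config_crossings_def Cr_def)
  then have "U = {}" using 0 by simp
  then have "config_crossings n (\<sigma>, E) \<subseteq> {t<..} \<times> UNIV"
    using 0 by (auto simp: subset_iff) (metis le_neq_implies_less)
  then show ?case using later[OF p _ 0(3)] \<open>U = {}\<close> by simp
next
  case (Suc k U E)
  have fin: "finite U" using Suc.hyps(2) by (intro card_ge_0_finite) simp
  define y where "y = Max U"
  have y: "y \<in> U" "\<And>z. z \<in> U \<Longrightarrow> z \<le> y"
    using fin Suc.hyps(2) by (auto simp: y_def intro!: Max_in)
  have ty: "(t, y) \<in> config_crossings n (\<sigma>, E)" using y Suc.prems by simp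
  have max: "maximal_crossing n (\<sigma>, E) (t, y)"
    unfolding maximal_crossing_def cell_succeq_def
  proof (intro conjI ballI impI ty)
    fix d assume d: "d \<in> config_crossings n (\<sigma>, E)" "fst d \<le> fst (t, y) \<and> snd (t, y) \<le> snd d"
    then have "fst d = t" using Suc.prems(1) by (cases d) auto
    then have "snd d \<in> U" using d(1) Suc.prems(3) by (cases d) auto
    then show "d = (t, y)" using y(2)[of "snd d"] d(2) \<open>fst d = t\<close> by (cases d) auto
  qed
  have tyC: "(t, y) \<in> Cr n \<sigma>" using ty by (simp add: config_crossings_def)
  note C = in_CrD[OF tyC p]
  have smooth: "outcome n (\<sigma>, insert (t, y) E) \<tau> \<longleftrightarrow>
    (\<exists>l. (l = t \<or> \<sigma> l \<in> U - {y}) \<and> column_process n (Suc t) (\<sigma> \<circ> Transposition.transpose t l) \<tau>)"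
  proof (rule Suc.hyps(1))
    show "k = card (U - {y})" using Suc.hyps(2) y(1) fin by simp
    show "config_crossings n (\<sigma>, insert (t, y) E) \<subseteq> {t..} \<times> UNIV"
      using Suc.prems(1) by (auto simp: config_crossings_def)
    show "insert (t, y) E \<subseteq> {..t} \<times> UNIV" using Suc.prems(2) by auto
    show "U - {y} = {ya. (t, ya) \<in> config_crossings n (\<sigma>, insert (t, y) E)}"
      unfolding Suc.prems(3) by (auto simp: config_crossings_def)
  qed
  define \<sigma>' where "\<sigma>' = switched \<sigma> (t, y)"
  have s: "\<sigma>' x = (if x = t then y else if x = inv \<sigma> y then \<sigma> t else \<sigma> x)" for x
    using C by (simp add: \<sigma>'_def switched_def transpose_def)
  have inv: "inv \<sigma>' z = (if z = y then t else if z = \<sigma> t then inv \<sigma> y else inv \<sigma> z)" for z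
  proof -
    have "inv \<sigma> z = t \<longleftrightarrow> z = \<sigma> t" "inv \<sigma> z = inv \<sigma> y \<longleftrightarrow> z = y"
      using p C by (auto simp: permutes_inv_eq)
    then show ?thesis
      unfolding \<sigma>'_def switched_def inv_comp_transpose[OF p]
      using C by (auto simp: transpose_def)
  qed
  have "config_crossings n (\<sigma>', E) \<subseteq> {t<..} \<times> UNIV"
  proof (clarsimp, rule ccontr)
    fix x z assume xz: "(x, z) \<in> config_crossings n (\<sigma>', E)" and "\<not> t < x"
    then have r: "x \<le> t" "x \<in> {1..n}" "z \<in> {1..n}" "x < inv \<sigma>' z" "\<sigma>' x < z" "(x, z) \<notin> E"
      by (auto simp: config_crossings_def Cr_def)
    have "x < inv \<sigma> z" "\<sigma> x < z"
      using r C p by (auto simp: s inv permutes_inverses(2) split: if_splits)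
    then have xz': "(x, z) \<in> config_crossings n (\<sigma>, E)"
      using r by (auto simp: config_crossings_def Cr_def)
    then have "x = t" using Suc.prems(1) r(1) by auto
    then have "z \<le> y" "y < z" using y(2)[of z] xz' Suc.prems(3) r(5) by (auto simp: s)
    then show False by simp
  qed
  then have switch: "outcome n (\<sigma>', E) \<tau> \<longleftrightarrow> column_process n (Suc t) \<sigma>' \<tau>"
    using later[OF _ _ Suc.prems(2)] switched_permutes[OF p tyC] by (simp add: \<sigma>'_def)
  have l: "\<sigma> l = y \<longleftrightarrow> l = inv \<sigma> y" for l using p permutes_inv_eq by metis
  have "(\<exists>l. (l = t \<or> \<sigma> l \<in> U) \<and> column_process n (Suc t) (\<sigma> \<circ> Transposition.transpose t l) \<tau>) \<longleftrightarrow>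
     (\<exists>l. (l = t \<or> \<sigma> l \<in> U - {y}) \<and> column_process n (Suc t) (\<sigma> \<circ> Transposition.transpose t l) \<tau>) \<or>
     (\<exists>l. \<sigma> l = y \<and> column_process n (Suc t) (\<sigma> \<circ> Transposition.transpose t l) \<tau>)"
    using y(1) by blast
  also have "(\<exists>l. \<sigma> l = y \<and> column_process n (Suc t) (\<sigma> \<circ> Transposition.transpose t l) \<tau>) \<longleftrightarrow>
     column_process n (Suc t) \<sigma>' \<tau>"
    by (simp add: l \<sigma>'_def switched_def)
  finally have fin: "(\<exists>l. (l = t \<or> \<sigma> l \<in> U) \<and> column_process n (Suc t) (\<sigma> \<circ> Transposition.transpose t l) \<tau>) \<longleftrightarrow>
     (\<exists>l. (l = t \<or> \<sigma> l \<in> U - {y}) \<and> column_process n (Suc t) (\<sigma> \<circ> Transposition.transpose t l) \<tau>) \<or>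
     column_process n (Suc t) \<sigma>' \<tau>" .
  show ?case
    unfolding outcome_maximal[OF p max] smooth fin switch[unfolded \<sigma>'_def] \<sigma>'_def by (rule refl)
qed

text \<open>
  The hypotheses on the configuration hold at the start and are preserved by finishing a column: to the left of
  column \<open>t\<close> nothing is left to resolve, and from column \<open>t\<close> on nothing has been smoothed yet.
\<close>

lemma outcome_iff_column_process:
  assumes "1 \<le> t" "t \<le> Suc n" "\<sigma> permutes {1..n}" "config_crossings n (\<sigma>, E) \<subseteq> {t..} \<times> UNIV"
    "E \<subseteq> {..<t} \<times> UNIV"
  shows "outcome n (\<sigma>, E) \<tau> \<longleftrightarrow> column_process n t \<sigma> \<tau>"
  using assms(2,1,3-)
proof (induction t arbitrary: \<sigma> E rule: inc_induct)
  case base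
  have "config_crossings n (\<sigma>, E) = {}"
    using base(3) by (auto simp: config_crossings_def Cr_def)
  then show ?case by (simp add: outcome_final column_process_Suc_iff)
next
  case (step t)
  let ?U = "{y. (t, y) \<in> config_crossings n (\<sigma>, E)}"
  have "outcome n (\<sigma>, E) \<tau> \<longleftrightarrow>
    (\<exists>l. (l = t \<or> \<sigma> l \<in> ?U) \<and> column_process n (Suc t) (\<sigma> \<circ> Transposition.transpose t l) \<tau>)"
  proof (rule outcome_column)
    fix \<sigma> E assume "\<sigma> permutes {1..n}" "config_crossings n (\<sigma>, E) \<subseteq> {t<..} \<times> UNIV"
      "E \<subseteq> {..t} \<times> UNIV"
    then show "outcome n (\<sigma>, E) \<tau> \<longleftrightarrow> column_process n (Suc t) \<sigma> \<tau>"
      using step.IH[of \<sigma> E] by (simp add: lessThan_Suc_atMost atLeast_Suc_greaterThan)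
  qed (use step.prems in auto)
  also have "\<dots> \<longleftrightarrow> column_process n t \<sigma> \<tau>"
  proof -
    have "(l = t \<or> \<sigma> l \<in> ?U) \<longleftrightarrow> t \<le> l \<and> l \<le> n \<and> \<sigma> t \<le> \<sigma> l" for l
    proof -
      have "\<sigma> l \<in> ?U \<longleftrightarrow> l \<in> {1..n} \<and> t < l \<and> \<sigma> t < \<sigma> l"
        using step permutes_in_image[OF step.prems(2), of l]
        by (auto simp: config_crossings_def Cr_def permutes_inverses(2)[OF step.prems(2)])
      moreover have "\<sigma> l = \<sigma> t \<longleftrightarrow> l = t"
        using permutes_inj[OF step.prems(2)] by (auto dest: injD)
      ultimately show ?thesis using step.prems(1) step.hyps by (auto simp: le_less)
    qed
    then show ?thesis using column_process_iff[of t n \<sigma> \<tau>] step.hyps by auto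
  qed
  finally show ?case .
qed

lemma web_permutation_iff_column_process: "web_permutation n \<tau> \<longleftrightarrow> column_process n 1 id \<tau>"
proof -
  have "web_permutation n \<tau> \<longleftrightarrow> outcome n (id, {}) \<tau>"
    by (simp add: web_permutation_def outcome_def)
  also have "\<dots> \<longleftrightarrow> column_process n 1 id \<tau>"
    by (rule outcome_iff_column_process) (auto simp: permutes_id config_crossings_def Cr_def)
  finally show ?thesis .
qed

section \<open>The matching and the Lehmer code\<close>

definition rows_from :: "nat \<Rightarrow> (nat \<Rightarrow> nat) \<Rightarrow> nat \<Rightarrow> nat set" where
  "rows_from n \<sigma> t = {z \<in> {1..n}. t \<le> inv \<sigma> z}"

definition lehmer :: "nat \<Rightarrow> (nat \<Rightarrow> nat) \<Rightarrow> nat \<Rightarrow> nat" where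
  "lehmer n \<sigma> t = card {z \<in> rows_from n \<sigma> t. z < \<sigma> t}"

text \<open>
  Every curve of the grid contains exactly one mark, and is named after the column of this mark.
  Columns \<open>t, ..., n\<close> form a smaller grid, whose boundary segments are numbered from 0, first the
  left ones of the remaining rows and then the top ones; \<open>label_at n \<sigma> t r\<close> is the name of the
  curve that ends in boundary segment \<open>r\<close>.  The recursion says that column \<open>t\<close> inserts the two
  ends of curve \<open>t\<close> next to each other at the position given by the Lehmer code.
\<close>

function label_at :: "nat \<Rightarrow> (nat \<Rightarrow> nat) \<Rightarrow> nat \<Rightarrow> nat \<Rightarrow> nat" where
  "label_at n \<sigma> t r =
    (if n < t then 0
     else if r < lehmer n \<sigma> t then label_at n \<sigma> (Suc t) r
     else if r \<le> Suc (lehmer n \<sigma> t) then t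
     else label_at n \<sigma> (Suc t) (r - 2))"
  by auto
termination by (relation "measure (\<lambda>(n, \<sigma>, t, r). Suc n - t)") auto

declare label_at.simps [simp del]

text \<open>
  Also an inner segment lies on the curve of some boundary segment of a smaller grid.  A horizontal
  segment in column \<open>i\<close> is reached from the next row above it that still has its mark to come, or
  from the top of the column if there is none; in both cases the number of that boundary segment is
  the number of remaining rows at or below the given segment.
\<close>

fun segment_label :: "nat \<Rightarrow> (nat \<Rightarrow> nat) \<Rightarrow> segment \<Rightarrow> nat" where
  "segment_label n \<sigma> (VSeg i y) = label_at n \<sigma> (Suc i) (card {z \<in> rows_from n \<sigma> (Suc i). z < y})"
| "segment_label n \<sigma> (HSeg i y) = label_at n \<sigma> i (card {z \<in> rows_from n \<sigma> i. z \<le> y})"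

text \<open>
  The boundary segments of the grid formed by columns \<open>t, ..., n\<close>, with their numbers.
\<close>

definition frontier :: "nat \<Rightarrow> (nat \<Rightarrow> nat) \<Rightarrow> nat \<Rightarrow> nat \<Rightarrow> segment \<Rightarrow> bool" where
  "frontier n \<sigma> t r P \<longleftrightarrow>
    (\<exists>y \<in> rows_from n \<sigma> t. P = VSeg (t - 1) y \<and> r = card {z \<in> rows_from n \<sigma> t. z < y}) \<or>
    (\<exists>c. t \<le> c \<and> c \<le> n \<and> P = HSeg c n \<and> r = (Suc n - t) + (c - t))"

definition joined :: "nat \<Rightarrow> (nat \<Rightarrow> nat) \<Rightarrow> segment \<Rightarrow> segment \<Rightarrow> bool" where
  "joined n \<sigma> = (symclp (cell_arc n \<sigma>))\<^sup>*\<^sup>*"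

lemma joined_arc: "cell_arc n \<sigma> P Q \<Longrightarrow> joined n \<sigma> P Q"
  by (auto simp: joined_def symclp_def)

lemma joined_sym: "joined n \<sigma> P Q \<Longrightarrow> joined n \<sigma> Q P"
  unfolding joined_def by (rule sympD[OF symp_rtranclp_symclp])

lemma joined_trans: "joined n \<sigma> P Q \<Longrightarrow> joined n \<sigma> Q R \<Longrightarrow> joined n \<sigma> P R"
  unfolding joined_def by (rule rtranclp_trans)

lemma joined_refl: "joined n \<sigma> P P"
  by (simp add: joined_def)

context
  fixes n :: nat and \<sigma> :: "nat \<Rightarrow> nat"
  assumes p: "\<sigma> permutes {1..n}"
begin

lemma rows_from_iff: "\<sigma> m \<in> rows_from n \<sigma> t \<longleftrightarrow> m \<in> {1..n} \<and> t \<le> m"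
  using permutes_in_image[OF p, of m] by (auto simp: rows_from_def permutes_inverses(2)[OF p])

lemma rows_from_Suc: "rows_from n \<sigma> (Suc t) = rows_from n \<sigma> t - {\<sigma> t}"
proof -
  have "inv \<sigma> z = t \<longleftrightarrow> z = \<sigma> t" for z using permutes_inv_eq[OF p, of z t] by auto
  then have "Suc t \<le> inv \<sigma> z \<longleftrightarrow> t \<le> inv \<sigma> z \<and> z \<noteq> \<sigma> t" for z
    by (metis Suc_le_eq le_neq_implies_less less_imp_le order_less_irrefl)
  then show ?thesis by (auto simp: rows_from_def)
qed

lemma finite_rows_from [simp]: "finite (rows_from n \<sigma> t)"
  by (simp add: rows_from_def)

lemma rows_from_image: "rows_from n \<sigma> t = \<sigma> ` {m \<in> {1..n}. t \<le> m}"
proof -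
  have "z \<in> rows_from n \<sigma> t \<longleftrightarrow> z \<in> \<sigma> ` {m \<in> {1..n}. t \<le> m}" for z
    using rows_from_iff[of "inv \<sigma> z" t] rows_from_iff[of _ t] permutes_inverses(1)[OF p, of z] by (metis (no_types, lifting) imageE imageI mem_Collect_eq)
  then show ?thesis by blast
qed

lemma card_rows_from:
  assumes "1 \<le> t"
  shows "card (rows_from n \<sigma> t) = Suc n - t"
proof -
  have "{m \<in> {1..n}. t \<le> m} = {t..n}" using assms by auto
  then show ?thesis unfolding rows_from_image
    using permutes_inj_on[OF p] by (simp add: card_image)
qed

lemma lehmer_le:
  assumes "1 \<le> t" "t \<le> n"
  shows "lehmer n \<sigma> t \<le> n - t"
proof -
  have "lehmer n \<sigma> t \<le> card (rows_from n \<sigma> (Suc t))"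
    unfolding lehmer_def by (rule card_mono) (auto simp: rows_from_Suc)
  then show ?thesis using card_rows_from[of "Suc t"] by simp
qed

lemma count_below:
  assumes "1 \<le> t" "t \<le> n"
  shows "card {z \<in> rows_from n \<sigma> t. z \<le> \<sigma> t} = Suc (lehmer n \<sigma> t)"
proof -
  have "{z \<in> rows_from n \<sigma> t. z \<le> \<sigma> t} = insert (\<sigma> t) {z \<in> rows_from n \<sigma> t. z < \<sigma> t}"
    using rows_from_iff[of t t] assms by auto
  then show ?thesis by (simp add: lehmer_def)
qed

lemma count_low: "y \<le> \<sigma> t \<Longrightarrow> {z \<in> rows_from n \<sigma> (Suc t). z < y} = {z \<in> rows_from n \<sigma> t. z < y}"
  by (auto simp: rows_from_Suc)

lemma count_high:
  assumes "1 \<le> t" "t \<le> n" "j \<in> rows_from n \<sigma> t" "\<sigma> t < j"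
  shows "card {z \<in> rows_from n \<sigma> t. z \<le> j} = card {z \<in> rows_from n \<sigma> (Suc t). z < j} + 2"
    and "lehmer n \<sigma> t \<le> card {z \<in> rows_from n \<sigma> (Suc t). z < j}"
proof -
  have "{z \<in> rows_from n \<sigma> t. z \<le> j} = insert j (insert (\<sigma> t) {z \<in> rows_from n \<sigma> (Suc t). z < j})"
    using rows_from_iff[of t t] assms by (auto simp: rows_from_Suc)
  then show "card {z \<in> rows_from n \<sigma> t. z \<le> j} = card {z \<in> rows_from n \<sigma> (Suc t). z < j} + 2"
    using assms(4) by (simp add: rows_from_Suc)
  show "lehmer n \<sigma> t \<le> card {z \<in> rows_from n \<sigma> (Suc t). z < j}"
    unfolding lehmer_def using assms(4) by (intro card_mono) (auto simp: rows_from_Suc)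
qed

lemma label_at_low: "t \<le> n \<Longrightarrow> r < lehmer n \<sigma> t \<Longrightarrow> label_at n \<sigma> t r = label_at n \<sigma> (Suc t) r"
  by (subst label_at.simps) simp

lemma label_at_mid: "t \<le> n \<Longrightarrow> r = lehmer n \<sigma> t \<or> r = Suc (lehmer n \<sigma> t) \<Longrightarrow> label_at n \<sigma> t r = t"
  by (subst label_at.simps) auto

lemma label_at_high: "t \<le> n \<Longrightarrow> lehmer n \<sigma> t \<le> r \<Longrightarrow> label_at n \<sigma> t (r + 2) = label_at n \<sigma> (Suc t) r"
  by (subst label_at.simps) auto

text \<open>
  The number, in the grid without column \<open>t\<close>, of the boundary segment to which column \<open>t\<close> carries
  boundary segment \<open>r\<close>, if \<open>r\<close> is not one of the two ends of curve \<open>t\<close>.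
\<close>

definition later_index :: "nat \<Rightarrow> nat \<Rightarrow> nat" where
  "later_index t r = (if r < lehmer n \<sigma> t then r else r - 2)"

lemma later_index_inj:
  assumes "later_index t a = later_index t b"
    and "a \<noteq> lehmer n \<sigma> t" "a \<noteq> Suc (lehmer n \<sigma> t)" "b \<noteq> lehmer n \<sigma> t" "b \<noteq> Suc (lehmer n \<sigma> t)"
  shows "a = b"
  using assms by (auto simp: later_index_def split: if_splits)

lemma label_at_later_index:
  assumes "t \<le> n" "r \<noteq> lehmer n \<sigma> t" "r \<noteq> Suc (lehmer n \<sigma> t)"
  shows "label_at n \<sigma> t r = label_at n \<sigma> (Suc t) (later_index t r)"
  using assms by (subst label_at.simps) (auto simp: later_index_def)

lemma later_index_less:
  assumes "1 \<le> t" "t \<le> n" "r < 2 * (Suc n - t)"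
    "r \<noteq> lehmer n \<sigma> t" "r \<noteq> Suc (lehmer n \<sigma> t)"
  shows "later_index t r < 2 * (Suc n - Suc t)"
  using assms lehmer_le[of t] by (auto simp: later_index_def)

lemma label_at_ge:
  assumes "t \<le> Suc n" "1 \<le> t" "r < 2 * (Suc n - t)"
  shows "t \<le> label_at n \<sigma> t r"
  using assms
proof (induction t arbitrary: r rule: inc_induct)
  case base
  then show ?case by simp
next
  case (step t)
  then have t: "1 \<le> t" "t \<le> n" by auto
  show ?case
  proof (cases "r = lehmer n \<sigma> t \<or> r = Suc (lehmer n \<sigma> t)")
    case True
    then show ?thesis using label_at_mid[OF t(2)] by simp
  next
    case False
    then show ?thesis
      using label_at_later_index[OF t(2), of r] later_index_less[OF t step.prems(2)] step.IH[of "later_index t r"] by simp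
  qed
qed

lemma label_at_eq_iff:
  assumes "1 \<le> t" "t \<le> n" "r < 2 * (Suc n - t)"
  shows "label_at n \<sigma> t r = t \<longleftrightarrow> r = lehmer n \<sigma> t \<or> r = Suc (lehmer n \<sigma> t)"
proof -
  have "label_at n \<sigma> t r \<noteq> t" if "r \<noteq> lehmer n \<sigma> t" "r \<noteq> Suc (lehmer n \<sigma> t)"
    using label_at_later_index[OF assms(2) that] label_at_ge[of "Suc t" "later_index t r"] later_index_less[OF assms that] assms
    by simp
  then show ?thesis using label_at_mid[OF assms(2)] by blast
qed

lemma label_at_at_most_twice:
  assumes "t \<le> Suc n" "1 \<le> t" "a < 2 * (Suc n - t)" "b < 2 * (Suc n - t)" "c < 2 * (Suc n - t)"
    "label_at n \<sigma> t a = label_at n \<sigma> t b" "label_at n \<sigma> t a = label_at n \<sigma> t c" "a \<noteq> b"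
  shows "c = a \<or> c = b"
  using assms
proof (induction t arbitrary: a b c rule: inc_induct)
  case base
  then show ?case by simp
next
  case (step t)
  then have t: "1 \<le> t" "t \<le> n" by auto
  note iff = label_at_eq_iff[OF t step.prems(2)] label_at_eq_iff[OF t step.prems(3)] label_at_eq_iff[OF t step.prems(4)]
  show ?case
  proof (cases "label_at n \<sigma> t a = t")
    case True
    then show ?thesis using iff step.prems(5-7) by auto
  next
    case False
    then have out: "a \<noteq> lehmer n \<sigma> t" "a \<noteq> Suc (lehmer n \<sigma> t)" "b \<noteq> lehmer n \<sigma> t"
      "b \<noteq> Suc (lehmer n \<sigma> t)" "c \<noteq> lehmer n \<sigma> t" "c \<noteq> Suc (lehmer n \<sigma> t)"
      using iff step.prems(5,6) by auto
    have "later_index t c = later_index t a \<or> later_index t c = later_index t b"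
    proof (rule step.IH)
      show "later_index t a \<noteq> later_index t b" using later_index_inj[of t a b] out step.prems(7) by blast
    qed (use out step.prems label_at_later_index[OF t(2)] later_index_less[OF t] in auto)
    then show ?thesis using later_index_inj[of t c a] later_index_inj[of t c b] out by blast
  qed
qed

text \<open>
  Equality of labels is an invariant of connectedness, which shows that segments with different labels
  are not joined.
\<close>

lemma cell_arc_segment_label:
  assumes "cell_arc n \<sigma> P Q"
  shows "segment_label n \<sigma> P = segment_label n \<sigma> Q"
  using assms
proof cases
  case (mark i)
  then have i: "1 \<le> i" "i \<le> n" by auto
  then show ?thesis using mark count_below[OF i] label_at_mid[of i] by (simp add: lehmer_def)
next
  case (elbow_left_bottom c)
  then have "1 \<le> fst c" "1 \<le> snd c" by (auto simp: Cr_def)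
  moreover from this have "{z \<in> rows_from n \<sigma> (fst c). z < snd c} = {z \<in> rows_from n \<sigma> (fst c). z \<le> snd c - 1}"
    by auto
  ultimately show ?thesis using elbow_left_bottom by simp
next
  case (elbow_right_top c)
  then have "fst c \<in> {1..n}" "snd c \<in> rows_from n \<sigma> (fst c)" "\<sigma> (fst c) < snd c"
    by (auto simp: Cr_def rows_from_def)
  then show ?thesis using elbow_right_top count_high[of "fst c" "snd c"] label_at_high[of "fst c"] by simp
next
  case (horizontal i j)
  then have i: "1 \<le> i" "i \<le> n" by auto
  have "j \<in> rows_from n \<sigma> i" using horizontal by (simp add: rows_from_def)
  then have "{z \<in> rows_from n \<sigma> i. z < j} \<subset> {z \<in> rows_from n \<sigma> i. z < \<sigma> i}"
    using horizontal by auto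
  then have "card {z \<in> rows_from n \<sigma> i. z < j} < lehmer n \<sigma> i"
    unfolding lehmer_def by (intro psubset_card_mono) auto
  then show ?thesis using horizontal i label_at_low[of i] count_low[of j i] by simp
next
  case (vertical i j)
  have "z \<le> j - 1 \<longleftrightarrow> z \<le> j" if "z \<in> rows_from n \<sigma> i" for z
    using vertical that by (cases "z = j") (auto simp: rows_from_def)
  then have "{z \<in> rows_from n \<sigma> i. z \<le> j - 1} = {z \<in> rows_from n \<sigma> i. z \<le> j}" by blast
  then show ?thesis using vertical by simp
qed

lemma joined_segment_label: "joined n \<sigma> P Q \<Longrightarrow> segment_label n \<sigma> P = segment_label n \<sigma> Q"
  unfolding joined_def
  by (induction rule: rtranclp_induct) (auto simp: symclp_def dest: cell_arc_segment_label)

lemma label_at_top: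
  assumes "1 \<le> i" "i \<le> Suc n"
  shows "label_at n \<sigma> i (Suc n - i + c) = label_at n \<sigma> 1 (n + (i - 1) + c)"
  using assms
proof (induction i arbitrary: c rule: dec_induct)
  case base
  then show ?case by simp
next
  case (step i)
  then have "label_at n \<sigma> (Suc i) (n - i + c) = label_at n \<sigma> i (n - i + c + 2)"
    using lehmer_le[of i] by (intro label_at_high[symmetric]) auto
  also have "n - i + c + 2 = Suc n - i + (c + 1)" using step by simp
  also have "label_at n \<sigma> i \<dots> = label_at n \<sigma> 1 (n + (i - 1) + (c + 1))"
    by (rule step.IH[OF Suc_leD[OF step.prems]])
  finally have "label_at n \<sigma> (Suc i) (n - i + c) = label_at n \<sigma> 1 (n + (i - 1) + (c + 1))" .
  moreover have "n + (i - 1) + (c + 1) = n + (Suc i - 1) + c" "Suc n - Suc i + c = n - i + c"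
    using step.hyps by auto
  ultimately show ?case by (simp only:)
qed

lemma rows_from_1: "rows_from n \<sigma> 1 = {1..n}"
proof -
  have "1 \<le> inv \<sigma> z" if "z \<in> {1..n}" for z
    using permutes_in_image[OF permutes_inv[OF p], of z] that by simp
  then show ?thesis by (auto simp: rows_from_def)
qed

lemma segment_label_boundary:
  assumes "a < 2 * n"
  shows "segment_label n \<sigma> (boundary_segment n a) = label_at n \<sigma> 1 a"
proof (cases "a < n")
  case True
  then have "{z \<in> rows_from n \<sigma> (Suc 0). z < Suc a} = {1..a}" using rows_from_1 by auto
  then show ?thesis using True by (simp add: boundary_segment_def)
next
  case False
  define i where "i = a - n + 1"
  have i: "1 \<le> i" "i \<le> n" "a = n + (i - 1)" using False assms by (auto simp: i_def)
  have "{z \<in> rows_from n \<sigma> i. z \<le> n} = rows_from n \<sigma> i" by (auto simp: rows_from_def)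
  then show ?thesis
    using label_at_top[of i 0] i card_rows_from[of i] False by (simp add: boundary_segment_def flip: i_def)
qed

lemma joined_vertical:
  assumes "t \<in> {1..n}" "\<sigma> t \<le> y" "y \<le> z" "z \<le> n" "\<And>j. y < j \<Longrightarrow> j \<le> z \<Longrightarrow> j \<notin> rows_from n \<sigma> t"
  shows "joined n \<sigma> (HSeg t y) (HSeg t z)"
  using assms(3-)
proof (induction z rule: dec_induct)
  case base
  then show ?case by (simp add: joined_refl)
next
  case (step z)
  have "Suc z \<notin> rows_from n \<sigma> t" "Suc z \<in> {1..n}" using step.prems(2)[of "Suc z"] step by auto
  then have "cell_arc n \<sigma> (bottom_side (t, Suc z)) (top_side (t, Suc z))"
    using assms(1,2) step.hyps by (intro cell_arc.vertical) (auto simp: rows_from_def)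
  then show ?case using step joined_arc joined_trans by (metis diff_Suc_1 fst_conv le_SucI snd_conv Suc_leD)
qed

text \<open>
  A curve that meets column \<open>t\<close> at height \<open>h\<close> above the mark follows the column down to the next
  remaining row, where an elbow sends it to the right, or else down to the mark.
\<close>

lemma joined_down:
  assumes t: "t \<in> {1..n}" and h: "\<sigma> t \<le> h" "h \<le> n"
  defines "r \<equiv> card {z \<in> rows_from n \<sigma> t. z \<le> h}"
  shows "r = Suc (lehmer n \<sigma> t) \<and> joined n \<sigma> (HSeg t h) (HSeg t (\<sigma> t)) \<or>
    r \<ge> lehmer n \<sigma> t + 2 \<and> (\<exists>Q. frontier n \<sigma> (Suc t) (r - 2) Q \<and> joined n \<sigma> (HSeg t h) Q)"
proof -
  have st: "\<sigma> t \<in> rows_from n \<sigma> t" using rows_from_iff[of t t] t by simp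
  define y where "y = Max {z \<in> rows_from n \<sigma> t. z \<le> h}"
  have y: "y \<in> rows_from n \<sigma> t" "y \<le> h" "\<And>z. z \<in> rows_from n \<sigma> t \<Longrightarrow> z \<le> h \<Longrightarrow> z \<le> y"
  proof -
    have "y \<in> {z \<in> rows_from n \<sigma> t. z \<le> h}" unfolding y_def by (rule Max_in) (use st h in auto)
    then show "y \<in> rows_from n \<sigma> t" "y \<le> h" by auto
    show "z \<le> y" if "z \<in> rows_from n \<sigma> t" "z \<le> h" for z
      unfolding y_def using that by (intro Max_ge) auto
  qed
  have sy: "\<sigma> t \<le> y" using y(3) st h by simp
  have c: "joined n \<sigma> (HSeg t h) (HSeg t y)"
    using y sy h t by (intro joined_sym[OF joined_vertical]) (auto simp: not_le[symmetric])
  have r: "r = card {z \<in> rows_from n \<sigma> t. z \<le> y}"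
    unfolding r_def using y by (intro arg_cong[where f = card]) auto
  show ?thesis
  proof (cases "y = \<sigma> t")
    case True
    then show ?thesis using c r count_below[of t] t by simp
  next
    case False
    then have lt: "\<sigma> t < y" using sy by simp
    have "inv \<sigma> y \<noteq> t" using permutes_inv_eq[OF p, of y t] lt by auto
    then have "(t, y) \<in> Cr n \<sigma>" using t y lt by (auto simp: Cr_def rows_from_def)
    then have "joined n \<sigma> (HSeg t y) (VSeg t y)"
      using joined_sym[OF joined_arc[OF elbow_right_top[of "(t, y)" n \<sigma>]]] by simp
    then have "joined n \<sigma> (HSeg t h) (VSeg t y)" using c joined_trans by blast
    moreover have "frontier n \<sigma> (Suc t) (r - 2) (VSeg t y)"
      using y lt count_high(1)[of t y] t r by (simp add: frontier_def rows_from_Suc)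
    ultimately show ?thesis using count_high[of t y] t r y lt by auto
  qed
qed

lemma frontier_step:
  assumes t: "t \<in> {1..n}" and P: "frontier n \<sigma> t r P"
  shows "(r = lehmer n \<sigma> t \<or> r = Suc (lehmer n \<sigma> t)) \<and> joined n \<sigma> P (HSeg t (\<sigma> t)) \<or>
    r < lehmer n \<sigma> t \<and> (\<exists>Q. frontier n \<sigma> (Suc t) r Q \<and> joined n \<sigma> P Q) \<or>
    r \<ge> lehmer n \<sigma> t + 2 \<and> (\<exists>Q. frontier n \<sigma> (Suc t) (r - 2) Q \<and> joined n \<sigma> P Q)"
proof -
  from P consider (V) y where "y \<in> rows_from n \<sigma> t" "P = VSeg (t - 1) y" "r = card {z \<in> rows_from n \<sigma> t. z < y}"
    | (H) c where "t \<le> c" "c \<le> n" "P = HSeg c n" "r = (Suc n - t) + (c - t)"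
    unfolding frontier_def by blast
  then consider y where "y \<in> rows_from n \<sigma> t" "P = VSeg (t - 1) y" "r = card {z \<in> rows_from n \<sigma> t. z < y}" "y < \<sigma> t"
    | "P = VSeg (t - 1) (\<sigma> t)" "r = lehmer n \<sigma> t"
    | y where "y \<in> rows_from n \<sigma> t" "P = VSeg (t - 1) y" "r = card {z \<in> rows_from n \<sigma> t. z < y}" "\<sigma> t < y"
    | "P = HSeg t n" "r = Suc n - t"
    | c where "t < c" "c \<le> n" "P = HSeg c n" "r = (Suc n - t) + (c - t)"
  proof cases
    case (V y)
    consider "y < \<sigma> t" | "y = \<sigma> t" | "\<sigma> t < y" by linarith
    then show ?thesis
    proof cases
      case 1
      then show ?thesis by (rule that(1)[OF V])
    next
      case 2
      then show ?thesis using that(2) V by (simp add: lehmer_def)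
    next
      case 3
      then show ?thesis by (rule that(3)[OF V])
    qed
  next
    case (H c)
    show ?thesis
    proof (cases "c = t")
      case True
      then show ?thesis using that(4) H by simp
    next
      case False
      then show ?thesis using that(5)[of c] H by simp
    qed
  qed
  then show ?thesis
  proof cases
    case (1 y)
    have "{z \<in> rows_from n \<sigma> t. z < y} \<subset> {z \<in> rows_from n \<sigma> t. z < \<sigma> t}" using 1 by auto
    then have "r < lehmer n \<sigma> t" unfolding lehmer_def 1(3) by (intro psubset_card_mono) auto
    moreover have "inv \<sigma> y \<noteq> t" using permutes_inv_eq[OF p, of y t] 1 by auto
    then have "t < inv \<sigma> y" "y \<in> {1..n}" using 1 by (auto simp: rows_from_def)
    then have "joined n \<sigma> P (VSeg t y)"
      using joined_arc[OF horizontal[of t n y \<sigma>]] t 1 by simp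
    moreover have "frontier n \<sigma> (Suc t) r (VSeg t y)"
      using 1 count_low[of y t] by (simp add: frontier_def rows_from_Suc)
    ultimately show ?thesis by blast
  next
    case 2
    then show ?thesis using joined_arc[OF mark[OF t, of \<sigma>]] by simp
  next
    case (3 y)
    have "inv \<sigma> y \<noteq> t" using permutes_inv_eq[OF p, of y t] 3 by auto
    then have "(t, y) \<in> Cr n \<sigma>" using t 3 by (auto simp: Cr_def rows_from_def)
    then have c: "joined n \<sigma> P (HSeg t (y - 1))"
      using joined_arc[OF elbow_left_bottom[of "(t, y)" n \<sigma>]] 3 by simp
    have h: "\<sigma> t \<le> y - 1" "y - 1 \<le> n" using 3 by (auto simp: rows_from_def)
    have "{z \<in> rows_from n \<sigma> t. z \<le> y - 1} = {z \<in> rows_from n \<sigma> t. z < y}" using 3(4) by auto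
    then have r: "card {z \<in> rows_from n \<sigma> t. z \<le> y - 1} = r" using 3(3) by simp
    show ?thesis using joined_down[OF t h, unfolded r] joined_trans[OF c] by blast
  next
    case 4
    have "{z \<in> rows_from n \<sigma> t. z \<le> n} = rows_from n \<sigma> t" by (auto simp: rows_from_def)
    moreover have "\<sigma> t \<le> n" using permutes_in_image[OF p, of t] t by auto
    ultimately show ?thesis using joined_down[OF t, of n] 4 card_rows_from[of t] t by auto
  next
    case (5 c)
    have "frontier n \<sigma> (Suc t) (r - 2) P" unfolding frontier_def
      using 5 by (intro disjI2 exI[of _ c]) auto
    moreover have "r \<ge> lehmer n \<sigma> t + 2" using 5 lehmer_le[of t] t by auto
    ultimately show ?thesis using joined_refl by blast
  qed
qed

lemma frontier_less:
  assumes "1 \<le> t" "frontier n \<sigma> t r P"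
  shows "r < 2 * (Suc n - t)"
proof -
  have "card {z \<in> rows_from n \<sigma> t. z < y} < Suc n - t" if "y \<in> rows_from n \<sigma> t" for y
    unfolding card_rows_from[OF assms(1), symmetric] using that by (intro psubset_card_mono) auto
  then show ?thesis using assms(2) unfolding frontier_def by fastforce
qed

text \<open>
  Conversely, the two ends of curve \<open>t\<close> meet in the mark of column \<open>t\<close>, and all other curves are
  carried to the next column.
\<close>

lemma joined_if_label_at_eq:
  assumes "t \<le> Suc n" "1 \<le> t" "frontier n \<sigma> t a P" "frontier n \<sigma> t b Q"
    "label_at n \<sigma> t a = label_at n \<sigma> t b" "a \<noteq> b"
  shows "joined n \<sigma> P Q"
  using assms
proof (induction t arbitrary: a b P Q rule: inc_induct)
  case base
  then show ?case using frontier_less[of "Suc n" a P] by simp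
next
  case (step t)
  then have t: "1 \<le> t" "t \<le> n" "t \<in> {1..n}" by auto
  note iff = label_at_eq_iff[OF t(1,2) frontier_less[OF t(1) step.prems(2)]]
    label_at_eq_iff[OF t(1,2) frontier_less[OF t(1) step.prems(3)]]
  have mid: "joined n \<sigma> R (HSeg t (\<sigma> t))" if "frontier n \<sigma> t r R" "r = lehmer n \<sigma> t \<or> r = Suc (lehmer n \<sigma> t)" for r R
    using frontier_step[OF t(3) that(1)] that(2) by auto
  have out: "\<exists>R'. frontier n \<sigma> (Suc t) (later_index t r) R' \<and> joined n \<sigma> R R'"
    if "frontier n \<sigma> t r R" "r \<noteq> lehmer n \<sigma> t" "r \<noteq> Suc (lehmer n \<sigma> t)" for r R
    using frontier_step[OF t(3) that(1)] that(2,3) by (auto simp: later_index_def)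
  show ?case
  proof (cases "label_at n \<sigma> t a = t")
    case True
    then show ?thesis
      using mid[OF step.prems(2)] mid[OF step.prems(3)] iff step.prems(4) joined_sym joined_trans by metis
  next
    case False
    then have o: "a \<noteq> lehmer n \<sigma> t" "a \<noteq> Suc (lehmer n \<sigma> t)" "b \<noteq> lehmer n \<sigma> t" "b \<noteq> Suc (lehmer n \<sigma> t)"
      using iff step.prems(4) by auto
    obtain P' Q' where PQ: "frontier n \<sigma> (Suc t) (later_index t a) P'" "joined n \<sigma> P P'"
      "frontier n \<sigma> (Suc t) (later_index t b) Q'" "joined n \<sigma> Q Q'"
      using out[OF step.prems(2) o(1,2)] out[OF step.prems(3) o(3,4)] by blast
    have "joined n \<sigma> P' Q'"
    proof (rule step.IH[OF _ PQ(1,3)])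
      show "later_index t a \<noteq> later_index t b" using later_index_inj[of t a b] o step.prems(5) by blast
    qed (use o step.prems(4) label_at_later_index[OF t(2)] in auto)
    then show ?thesis using PQ joined_sym joined_trans by blast
  qed
qed

lemma frontier_boundary:
  assumes "a < 2 * n"
  shows "frontier n \<sigma> 1 a (boundary_segment n a)"
proof (cases "a < n")
  case True
  then have "{z \<in> {1..n}. z < Suc a} = {1..a}" by auto
  then show ?thesis using True unfolding frontier_def rows_from_1 boundary_segment_def
    by (intro disjI1 bexI[of _ "a + 1"]) auto
next
  case False
  then show ?thesis using assms unfolding frontier_def boundary_segment_def
    by (intro disjI2 exI[of _ "a - n + 1"]) auto
qed

lemma joined_boundary_iff:
  assumes "a < 2 * n" "b < 2 * n" "a \<noteq> b"
  shows "joined n \<sigma> (boundary_segment n a) (boundary_segment n b) \<longleftrightarrow> label_at n \<sigma> 1 a = label_at n \<sigma> 1 b"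
  using joined_segment_label[of "boundary_segment n a" "boundary_segment n b"] segment_label_boundary assms
    joined_if_label_at_eq[OF _ _ frontier_boundary frontier_boundary] by auto

lemma matching_eq_matching0_iff:
  "matching n \<sigma> = matching0 n \<longleftrightarrow> (\<forall>i<n. label_at n \<sigma> 1 (2 * i) = label_at n \<sigma> 1 (2 * i + 1))"
proof -
  have m: "{a, b} \<in> matching n \<sigma> \<longleftrightarrow> a < 2 * n \<and> b < 2 * n \<and> a \<noteq> b \<and> label_at n \<sigma> 1 a = label_at n \<sigma> 1 b" for a b
    using joined_boundary_iff unfolding matching_def joined_def
    by (auto simp: doubleton_eq_iff)
  have m2: "\<exists>a b. X = {a, b}" if "X \<in> matching n \<sigma> \<or> X \<in> matching0 n" for X
    using that by (auto simp: matching_def matching0_def)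
  have m0: "{a, b} \<in> matching0 n \<longleftrightarrow> (\<exists>i<n. a = 2 * i \<and> b = 2 * i + 1 \<or> b = 2 * i \<and> a = 2 * i + 1)" for a b
    by (auto simp: matching0_def doubleton_eq_iff)
  show ?thesis
  proof
    assume eq: "matching n \<sigma> = matching0 n"
    show "\<forall>i<n. label_at n \<sigma> 1 (2 * i) = label_at n \<sigma> 1 (2 * i + 1)"
    proof (intro allI impI)
      fix i assume "i < n"
      then have "{2 * i, 2 * i + 1} \<in> matching0 n" using m0 by blast
      then show "label_at n \<sigma> 1 (2 * i) = label_at n \<sigma> 1 (2 * i + 1)" using eq m by blast
    qed
  next
    assume pr: "\<forall>i<n. label_at n \<sigma> 1 (2 * i) = label_at n \<sigma> 1 (2 * i + 1)"
    have "{a, b} \<in> matching n \<sigma> \<longleftrightarrow> {a, b} \<in> matching0 n" for a b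
    proof
      assume "{a, b} \<in> matching0 n"
      then show "{a, b} \<in> matching n \<sigma>" unfolding m m0 using pr by fastforce
    next
      assume "{a, b} \<in> matching n \<sigma>"
      then have ab: "a < 2 * n" "b < 2 * n" "a \<noteq> b" "label_at n \<sigma> 1 a = label_at n \<sigma> 1 b" using m by auto
      define i where "i = a div 2"
      have i: "i < n" "a = 2 * i \<or> a = 2 * i + 1" using ab(1) by (auto simp: i_def)
      define a' where "a' = (if a = 2 * i then 2 * i + 1 else 2 * i)"
      have "label_at n \<sigma> 1 a = label_at n \<sigma> 1 a'" "a' \<noteq> a" "a' < 2 * n" using i pr by (auto simp: a'_def)
      then have "b = a'" using label_at_at_most_twice[of 1 a a' b] ab by auto
      then show "{a, b} \<in> matching0 n" unfolding m0 using i by (auto simp: a'_def)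
    qed
    then show "matching n \<sigma> = matching0 n" using m2 by blast
  qed
qed

text \<open>
  Inserting two equal neighbours at position \<open>k\<close> into a sequence that is grouped in pairs keeps the
  grouping exactly if \<open>k\<close> is even.
\<close>

lemma paired_iff:
  assumes "1 \<le> t" "t \<le> Suc n"
  shows "(\<forall>i < Suc n - t. label_at n \<sigma> t (2 * i) = label_at n \<sigma> t (2 * i + 1)) \<longleftrightarrow>
    (\<forall>s \<in> {t..n}. even (lehmer n \<sigma> s))"
  using assms(2,1)
proof (induction t rule: inc_induct)
  case base
  then show ?case by simp
next
  case (step t)
  then have t: "1 \<le> t" "t \<le> n" by auto
  let ?k = "lehmer n \<sigma> t"
  have k: "?k \<le> n - t" using lehmer_le[OF t] .
  have "(\<forall>i < Suc n - t. label_at n \<sigma> t (2 * i) = label_at n \<sigma> t (2 * i + 1)) \<longleftrightarrow>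
     even ?k \<and> (\<forall>i < Suc n - Suc t. label_at n \<sigma> (Suc t) (2 * i) = label_at n \<sigma> (Suc t) (2 * i + 1))"
    (is "?L \<longleftrightarrow> _ \<and> ?R")
  proof (intro iffI conjI)
    assume L: ?L
    show "even ?k"
    proof (rule ccontr)
      assume "odd ?k"
      then obtain i where i: "?k = 2 * i + 1" by (elim oddE)
      then have "label_at n \<sigma> t (2 * i) = t" using L t k label_at_mid[of t ?k] by auto
      moreover have "label_at n \<sigma> t (2 * i) \<ge> Suc t"
        using label_at_low[of t "2 * i"] label_at_ge[of "Suc t" "2 * i"] i k t by auto
      ultimately show False by simp
    qed
    show ?R
    proof (intro allI impI)
      fix i assume i: "i < Suc n - Suc t"
      show "label_at n \<sigma> (Suc t) (2 * i) = label_at n \<sigma> (Suc t) (2 * i + 1)"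
      proof (cases "2 * i < ?k")
        case True
        then have "2 * i + 1 < ?k" using \<open>even ?k\<close> by (metis Suc_eq_plus1 Suc_lessI even_Suc even_mult_iff even_numeral)
        then show ?thesis using L[rule_format, of i] label_at_low[of t "2 * i"] label_at_low[of t "2 * i + 1"] True i t by simp
      next
        case False
        then show ?thesis
          using L[rule_format, of "Suc i"] label_at_high[of t "2 * i"] label_at_high[of t "2 * i + 1"] i t by simp
      qed
    qed
  next
    assume R: "even ?k \<and> ?R"
    show ?L
    proof (intro allI impI)
      fix i assume i: "i < Suc n - t"
      consider "2 * i < ?k" "2 * i + 1 < ?k" | "2 * i = ?k" | j where "i = Suc j" "?k \<le> 2 * j"
      proof -
        from R obtain m where "?k = 2 * m" by (auto elim: evenE)
        then show thesis using that by (cases "i < m"; cases "i = m"; cases i) auto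
      qed
      then show "label_at n \<sigma> t (2 * i) = label_at n \<sigma> t (2 * i + 1)"
      proof cases
        case 1
        then have "i < Suc n - Suc t" using k by simp
        then show ?thesis using R 1 label_at_low[of t "2 * i"] label_at_low[of t "2 * i + 1"] t by simp
      next
        case 2
        then show ?thesis using label_at_mid[of t "2 * i"] label_at_mid[of t "2 * i + 1"] t by simp
      next
        case (3 j)
        then show ?thesis
          using R i label_at_high[of t "2 * j"] label_at_high[of t "2 * j + 1"] t by simp
      qed
    qed
  qed
  also have "\<dots> \<longleftrightarrow> (\<forall>s \<in> {t..n}. even (lehmer n \<sigma> s))"
  proof -
    have "{t..n} = insert t {Suc t..n}" using t by auto
    then show ?thesis using step.IH by simp
  qed
  finally show ?case .
qed

lemma matching0_iff_even_lehmer: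
  "matching n \<sigma> = matching0 n \<longleftrightarrow> (\<forall>s \<in> {1..n}. even (lehmer n \<sigma> s))"
  using matching_eq_matching0_iff paired_iff[of 1] by simp

end

section \<open>A weight on matchings satisfying the Ptolemy relation\<close>

text \<open>
  The number with the given binary digits; exchanging a descent \<open>10\<close> for \<open>01\<close> and deleting a
  descent both make it smaller.
\<close>

fun binval :: "bool list \<Rightarrow> nat" where
  "binval [] = 0"
| "binval (x # b) = (if x then 2 ^ length b else 0) + binval b"

lemma binval_append: "binval (A @ B) = binval A * 2 ^ length B + binval B"
  by (induction A) (auto simp: algebra_simps power_add)

definition descents :: "bool list \<Rightarrow> (bool list \<times> bool list) set" where
  "descents b = {(A, B). b = A @ True # False # B}"

lemma binval_descent:
  assumes "(A, B) \<in> descents b"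
  shows "binval (A @ False # True # B) < binval b" "binval (A @ B) < binval b"
proof -
  have "binval B < 2 ^ length B" by (induction B) auto
  moreover have "(2::nat) ^ length B \<ge> 1" by simp
  ultimately show "binval (A @ False # True # B) < binval b" "binval (A @ B) < binval b"
    using assms by (auto simp: descents_def binval_append algebra_simps)
qed

text \<open>
  The rule for descents together with the value 1 at the empty word is what counting needs:
  exchanges and removals of arcs reduce the weight of every matching to the empty one.
\<close>

function word_weight :: "bool list \<Rightarrow> int" where
  "word_weight b =
    (if descents b = {} then 1
     else let d = SOME d. d \<in> descents b; A = fst d; B = snd d in
       word_weight (A @ False # True # B) - (if even (length A) then word_weight (A @ B) else 0))"
  by auto
termination
proof (relation "measure binval", goal_cases)
  case (2 b d A B)
  then show ?case using binval_descent(1)[of A B b] some_in_eq[of "descents b"] by auto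
next
  case (3 b d A B)
  then show ?case using binval_descent(2)[of A B b] some_in_eq[of "descents b"] by auto
qed simp

declare word_weight.simps [simp del]

lemma word_weight_Nil: "word_weight [] = 1"
  by (subst word_weight.simps) (auto simp: descents_def)

lemma descents_disjoint:
  assumes "A @ True # False # B = A' @ True # False # B'" "length A < length A'"
  obtains C where "A' = A @ True # False # C" "B = C @ True # False # B'"
proof -
  from assms obtain us where us: "A' = A @ us" "us @ True # False # B' = True # False # B"
    by (auto simp: append_eq_append_conv2)
  then obtain us' where "us = True # us'" using assms(2) by (cases us) auto
  moreover from this us obtain us'' where "us' = False # us''" by (cases us') auto
  ultimately show ?thesis using that us by auto
qed

text \<open>
  The definition uses one selected descent; the rule holds for every descent.  Two different
  descents are disjoint, and treating one of them does not change the parity of the position of the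
  other, so both orders of treating them give the same four terms.
\<close>

lemma word_weight_descent:
  "word_weight (A @ True # False # B) =
   word_weight (A @ False # True # B) - (if even (length A) then word_weight (A @ B) else 0)"
proof (induction "binval (A @ True # False # B)" arbitrary: A B rule: less_induct)
  case less
  define b where "b = A @ True # False # B"
  define d where "d = (SOME d. d \<in> descents b)"
  obtain A0 B0 where d: "d = (A0, B0)" by force
  have in1: "(A, B) \<in> descents b" by (simp add: b_def descents_def)
  then have "d \<in> descents b" unfolding d_def by (metis someI)
  then have in0: "(A0, B0) \<in> descents b" by (simp add: d)
  have b0: "b = A0 @ True # False # B0" using in0 by (simp add: descents_def)
  have ne: "descents b \<noteq> {}" using in0 by blast
  have wb: "word_weight b = word_weight (A0 @ False # True # B0) - (if even (length A0) then word_weight (A0 @ B0) else 0)"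
    using ne by (subst word_weight.simps) (simp add: Let_def d flip: d_def)
  have IH: "word_weight (X @ True # False # Y) =
      word_weight (X @ False # True # Y) - (if even (length X) then word_weight (X @ Y) else 0)"
    if "binval (X @ True # False # Y) < binval b" for X Y
    using less that by (simp add: b_def)
  note lt1 = binval_descent[OF in1] and lt0 = binval_descent[OF in0]
  consider "length A0 = length A" | "length A < length A0" | "length A0 < length A" by linarith
  then have "word_weight b = word_weight (A @ False # True # B) - (if even (length A) then word_weight (A @ B) else 0)"
  proof cases
    case 1
    then have "A0 = A" "B0 = B" using b0 by (auto simp: b_def)
    then show ?thesis using wb by simp
  next
    case 2
    then obtain C where C: "A0 = A @ True # False # C" "B = C @ True # False # B0"
      using b0 descents_disjoint[of A B A0 B0] by (auto simp: b_def)
    show ?thesis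
      using wb lt0 lt1 IH[of A "C @ False # True # B0"] IH[of A "C @ B0"]
        IH[of "A @ False # True # C" B0] IH[of "A @ C" B0]
      by (simp add: C)
  next
    case 3
    then obtain C where C: "A = A0 @ True # False # C" "B0 = C @ True # False # B"
      using b0 descents_disjoint[of A0 B0 A B] by (auto simp: b_def)
    show ?thesis
      using wb lt0 lt1 IH[of A0 "C @ False # True # B"] IH[of A0 "C @ B"]
        IH[of "A0 @ False # True # C" B] IH[of "A0 @ C" B]
      by (simp add: C)
  qed
  then show ?case by (simp add: b_def)
qed

text \<open>
  A matching is written as the list of the end points of its chords in their order on the line.  Each
  chord has a letter and a direction: \<open>(a, False)\<close> is the tail and \<open>(a, True)\<close> the head of chord
  \<open>a\<close>.  Directed chords make the exchange rule uniform, whether chords cross or not; reversing a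
  chord changes the sign of the weight.
\<close>

type_synonym token = "nat \<times> bool"

definition token_bit :: "nat set \<Rightarrow> token \<Rightarrow> bool" where
  "token_bit S x = ((fst x \<in> S) \<noteq> snd x)"

text \<open>
  The product of \<open>x\<^sub>h - x\<^sub>t\<close> over all chords with tail \<open>t\<close> and head \<open>h\<close>, with
  each monomial replaced by the weight of its exponent word.  The summation variable \<open>S\<close> consists of
  the chords that contribute the variable of their tail.
\<close>

definition matching_weight :: "nat set \<Rightarrow> token list \<Rightarrow> int" where
  "matching_weight X W = (\<Sum>S\<in>Pow X. (-1) ^ card S * word_weight (map (token_bit S) W))"

lemma sum_Pow_insert:
  assumes "finite X" "a \<notin> X"
  shows "(\<Sum>S\<in>Pow (insert a X). f S) = (\<Sum>S\<in>Pow X. f S + f (insert a S) :: int)"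
proof -
  have inj: "inj_on (insert a) (Pow X)"
    using assms(2) by (auto simp: inj_on_def)
  have "(\<Sum>S\<in>Pow (insert a X). f S) = (\<Sum>S\<in>Pow X. f S) + (\<Sum>S\<in>insert a ` Pow X. f S)"
    unfolding Pow_insert by (rule sum.union_disjoint) (use assms in auto)
  also have "(\<Sum>S\<in>insert a ` Pow X. f S) = (\<Sum>S\<in>Pow X. f (insert a S))"
    by (rule sum.reindex_cong[OF inj]) auto
  finally show ?thesis by (simp add: sum.distrib)
qed

lemma matching_weight_arc:
  assumes "finite X" "a \<notin> X" "a \<notin> fst ` set (A @ B)"
  shows "matching_weight (insert a X) (A @ (a, False) # (a, True) # B) =
    (if even (length A) then matching_weight X (A @ B) else 0)"
proof -
  let ?W = "A @ (a, False) # (a, True) # B"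
  have key: "(-1) ^ card S * word_weight (map (token_bit S) ?W) + (-1) ^ card (insert a S) * word_weight (map (token_bit (insert a S)) ?W)
    = (if even (length A) then (-1) ^ card S * word_weight (map (token_bit S) (A @ B)) else 0)"
    if "S \<in> Pow X" for S
  proof -
    have S: "finite S" "a \<notin> S" using that assms finite_subset by auto
    have m: "map (token_bit (insert a S)) A = map (token_bit S) A" "map (token_bit (insert a S)) B = map (token_bit S) B"
      using assms(3) by (auto simp: token_bit_def)
    have b: "token_bit S (a, False) = False" "token_bit S (a, True) = True"
       "token_bit (insert a S) (a, False) = True" "token_bit (insert a S) (a, True) = False"
      using S by (auto simp: token_bit_def)
    have e: "word_weight (map (token_bit S) A @ False # True # map (token_bit S) B) =
      word_weight (map (token_bit S) A @ True # False # map (token_bit S) B) +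
      (if even (length A) then word_weight (map (token_bit S) A @ map (token_bit S) B) else 0)"
      using word_weight_descent[of "map (token_bit S) A" "map (token_bit S) B"] by simp
    show ?thesis using S by (simp add: m b e distrib_left del: map_eq_conv)
  qed
  have "matching_weight (insert a X) ?W = (\<Sum>S\<in>Pow X. (-1) ^ card S * word_weight (map (token_bit S) ?W) +
      (-1) ^ card (insert a S) * word_weight (map (token_bit (insert a S)) ?W))"
    unfolding matching_weight_def using assms by (intro sum_Pow_insert) auto
  also have "\<dots> = (\<Sum>S\<in>Pow X.
      if even (length A) then (-1) ^ card S * word_weight (map (token_bit S) (A @ B)) else 0)"
    by (intro sum.cong key refl)
  finally show ?thesis by (simp add: matching_weight_def)
qed

text \<open>
  Let \<open>p\<close> and \<open>p + 1\<close> be the two exchanged positions, and write \<open>z\<close> and \<open>s\<close> for the variables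
  at the other ends of the chords \<open>z\<close> and \<open>j\<close>.  Then
  \<open>(x\<^sub>p - z) * (x\<^sub>p\<^sub>+\<^sub>1 - s) - (x\<^sub>p\<^sub>+\<^sub>1 - z) * (x\<^sub>p - s) = (s - z) * (x\<^sub>p\<^sub>+\<^sub>1 - x\<^sub>p)\<close>:
  the difference of the two matchings is the matching with an arc between the two neighbours and
  with \<open>z\<close> redirected to the other end of \<open>j\<close>.  If the exchanged end of \<open>j\<close> is its tail, then
  reversing \<open>j\<close> gives the sign.
\<close>

lemma matching_weight_exchange:
  fixes t :: bool
  assumes "finite X" "z \<notin> X" "j \<notin> X" "z \<noteq> j"
    and "\<And>x. x \<in> set (A @ B) \<Longrightarrow> fst x = j \<Longrightarrow> x = (j, \<not> t)"
  shows "matching_weight (insert z (insert j X)) (A @ (z, True) # (j, t) # B) =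
    matching_weight (insert z (insert j X)) (A @ (j, t) # (z, True) # B) +
    (if even (length A) then (if t then 1 else -1) *
        matching_weight (insert z X) (map (\<lambda>x. if fst x = j then (z, True) else x) (A @ B)) else 0)"
proof -
  let ?W = "A @ (z, True) # (j, t) # B" and ?W' = "A @ (j, t) # (z, True) # B"
  let ?M = "map (\<lambda>x. if fst x = j then (z, True) else x)"
  define D where "D S = (-1) ^ card S * (word_weight (map (token_bit S) ?W) - word_weight (map (token_bit S) ?W'))" for S
  define E where "E S = (if even (length A) then (if t then 1 else -1) *
     ((-1) ^ card S * word_weight (map (token_bit S) (?M (A @ B)))) else 0)" for S
  have key: "D S + D (insert j S) + (D (insert z S) + D (insert z (insert j S))) = E S + E (insert z S)"
    if "S \<in> Pow X" for S
  proof -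
    have S: "finite S" "z \<notin> S" "j \<notin> S" using that assms finite_subset by auto
    have c: "card (insert j S) = Suc (card S)" "card (insert z S) = Suc (card S)"
       "card (insert z (insert j S)) = Suc (Suc (card S))" using S assms(4) by auto
    let ?R = "\<lambda>T. (if even (length A) then word_weight (map (token_bit T) (A @ B)) else 0)"
    have d: "word_weight (map (token_bit T) ?W) - word_weight (map (token_bit T) ?W') =
       (if token_bit T (z, True) = token_bit T (j, t) then 0 else
        if token_bit T (z, True) then - ?R T else ?R T)" for T
      using word_weight_descent[of "map (token_bit T) A" "map (token_bit T) B"]
      by (cases "token_bit T (z, True)"; cases "token_bit T (j, t)") auto
    have b: "token_bit S (z, True)" "token_bit (insert j S) (z, True)" "\<not> token_bit (insert z S) (z, True)"
      "\<not> token_bit (insert z (insert j S)) (z, True)"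
      "token_bit S (j, t) = t" "token_bit (insert j S) (j, t) = (\<not> t)" "token_bit (insert z S) (j, t) = t"
      "token_bit (insert z (insert j S)) (j, t) = (\<not> t)"
      using S assms(4) by (auto simp: token_bit_def)
    have js: "b = (\<not> t)" if "(j, b) \<in> set A \<or> (j, b) \<in> set B" for b
      using assms(5)[of "(j, b)"] that by auto
    have m1: "map (token_bit (insert j S)) (A @ B) = map (token_bit S) (?M (A @ B))" if "t"
      using assms(4) S that js[of True] js[of False] by (auto simp: token_bit_def) ((metis (full_types))+)?
    have m2: "map (token_bit (insert z S)) (A @ B) = map (token_bit (insert z S)) (?M (A @ B))" if "t"
      using assms(4) S that js[of True] js[of False] by (auto simp: token_bit_def) ((metis (full_types))+)?
    have m3: "map (token_bit S) (A @ B) = map (token_bit S) (?M (A @ B))" if "\<not> t"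
      using assms(4) S that js[of True] js[of False] by (auto simp: token_bit_def) ((metis (full_types))+)?
    have m4: "map (token_bit (insert z (insert j S))) (A @ B) = map (token_bit (insert z S)) (?M (A @ B))" if "\<not> t"
      using assms(4) S that js[of True] js[of False] by (auto simp: token_bit_def) ((metis (full_types))+)?
    show ?thesis
      unfolding D_def E_def c d b
      using m1 m2 m3 m4 c(2) by (cases t) (simp_all add: b del: map_append map_map)
  qed
  have "matching_weight (insert z (insert j X)) ?W - matching_weight (insert z (insert j X)) ?W' =
     (\<Sum>S\<in>Pow (insert z (insert j X)). D S)"
    unfolding matching_weight_def D_def by (simp add: sum_subtractf right_diff_distrib)
  also have "\<dots> = (\<Sum>S\<in>Pow X. D S + D (insert j S) + (D (insert z S) + D (insert z (insert j S))))"
    using assms by (simp add: sum_Pow_insert insert_commute add.assoc)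
  also have "\<dots> = (\<Sum>S\<in>Pow X. E S + E (insert z S))"
    using key by (intro sum.cong) auto
  also have "\<dots> = (\<Sum>S\<in>Pow (insert z X). E S)"
    using assms by (simp add: sum_Pow_insert)
  also have "\<dots> = (if even (length A) then (if t then 1 else -1) *
        matching_weight (insert z X) (?M (A @ B)) else 0)"
    unfolding matching_weight_def E_def by (simp add: sum_distrib_left del: map_append map_map)
  finally show ?thesis by linarith
qed

lemma matching_weight_rename:
  assumes "inj_on f X" "fst ` set W \<subseteq> X" "finite X"
  shows "matching_weight (f ` X) (map (map_prod f id) W) = matching_weight X W"
proof -
  have "inj_on ((`) f) (Pow X)"
    using assms(1) by (simp add: inj_on_image_Pow)
  then have "matching_weight (f ` X) (map (map_prod f id) W) =
     (\<Sum>S\<in>Pow X. (-1) ^ card (f ` S) * word_weight (map (token_bit (f ` S)) (map (map_prod f id) W)))"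
    unfolding matching_weight_def by (subst image_Pow_surj[OF refl, symmetric], subst sum.reindex) auto
  also have "\<dots> = (\<Sum>S\<in>Pow X. (-1) ^ card S * word_weight (map (token_bit S) W))"
  proof (intro sum.cong refl)
    fix S assume "S \<in> Pow X"
    then have S: "S \<subseteq> X" by simp
    then have "card (f ` S) = card S" using assms(1) by (meson card_image inj_on_subset)
    moreover have "map (token_bit (f ` S)) (map (map_prod f id) W) = map (token_bit S) W"
      using assms(1,2) S by (auto simp: token_bit_def inj_on_image_mem_iff)
        (metis fst_conv imageI inj_on_image_mem_iff subsetD)+
    ultimately show "(-1) ^ card (f ` S) * word_weight (map (token_bit (f ` S)) (map (map_prod f id) W)) =
        (-1) ^ card S * word_weight (map (token_bit S) W)" by (simp del: map_map map_eq_conv)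
  qed
  finally show ?thesis by (simp add: matching_weight_def)
qed

definition tails :: "nat list \<Rightarrow> token list" where
  "tails = map (\<lambda>x. (x, False))"

definition heads :: "nat list \<Rightarrow> token list" where
  "heads = map (\<lambda>x. (x, True))"

lemma tails_simps [simp]:
  "tails [] = []" "tails (x # l) = (x, False) # tails l" "tails (k @ l) = tails k @ tails l"
  "length (tails l) = length l" "fst ` set (tails l) = set l"
  by (simp_all add: tails_def image_image)

lemma heads_simps [simp]:
  "heads [] = []" "heads (x # l) = (x, True) # heads l" "heads (k @ l) = heads k @ heads l"
  "length (heads l) = length l" "fst ` set (heads l) = set l"
  by (simp_all add: heads_def image_image)

lemma in_set_tails: "x \<in> set (tails l) \<longleftrightarrow> fst x \<in> set l \<and> \<not> snd x"
  by (cases x) (auto simp: tails_def)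

lemma in_set_heads: "x \<in> set (heads l) \<longleftrightarrow> fst x \<in> set l \<and> snd x"
  by (cases x) (auto simp: heads_def)

lemma redirect_tails:
  "j \<notin> set l \<Longrightarrow> map (\<lambda>x. if fst x = j then y else x) (tails l) = tails l"
  by (auto simp: tails_def)

lemma redirect_heads:
  "j \<notin> set l \<Longrightarrow> map (\<lambda>x. if fst x = j then y else x) (heads l) = heads l"
  by (auto simp: heads_def)

lemma redirect_heads':
  "map (\<lambda>x. if fst x = j then (a, True) else x) (heads l) =
   heads (map (\<lambda>x. if x = j then a else x) l)"
  by (auto simp: heads_def)

lemma sum_filter_insert:
  assumes "j \<notin> A" "finite A"
  shows "(\<Sum>k | k \<in> insert j A \<and> P k. T k) =
    (\<Sum>k | k \<in> A \<and> P k. T k) + (if P j then T j else 0 :: int)"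
proof -
  have "{k. k \<in> insert j A \<and> P k} = (if P j then insert j {k \<in> A. P k} else {k \<in> A. P k})"
    by auto
  then show ?thesis using assms by simp
qed

text \<open>
  The head of chord \<open>a\<close>, which belongs to the first column, moves to the left across the rows above
  \<open>a\<close> until it is next to its own tail; here it has passed \<open>q2\<close> and has \<open>q1\<close> still to pass.
  Passing row \<open>j\<close> contributes the diagram in which the first column takes the letter \<open>j\<close>.
\<close>

lemma matching_weight_column_aux:
  assumes r: "sorted (p @ a # q1 @ q2)" "distinct (p @ a # q1 @ q2)" "set c = set (p @ q1 @ q2)"
  shows "matching_weight (set (p @ a # q1 @ q2)) (tails (p @ a # q1) @ (a, True) # tails q2 @ heads c) =
    (if even (length p) then matching_weight (set (p @ a # q1 @ q2) - {a}) (tails (p @ q1 @ q2) @ heads c) else 0) +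
    (\<Sum>j | j \<in> set q1 \<and> even (card {x \<in> set (p @ a # q1 @ q2). x < j}). matching_weight (set (p @ a # q1 @ q2) - {j})
       (tails (remove1 j (p @ a # q1 @ q2)) @ heads (map (\<lambda>x. if x = j then a else x) c)))"
  using assms
proof (induction q1 arbitrary: q2 rule: rev_induct)
  case Nil
  have "set (p @ a # q2) = insert a (set (p @ q2))" by auto
  then show ?case
    using Nil matching_weight_arc[of "set (p @ q2)" a "tails p" "tails q2 @ heads c"]
    by (simp add: image_Un)
next
  case (snoc j q1)
  let ?r = "p @ a # (q1 @ [j]) @ q2"
  let ?X = "set ?r"
  let ?T = "\<lambda>j. matching_weight (?X - {j})
       (tails (remove1 j ?r) @ heads (map (\<lambda>x. if x = j then a else x) c))"
  let ?A = "tails (p @ a # q1)" and ?B = "tails q2 @ heads c"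
  have rk: "{x \<in> ?X. x < j} = set (p @ a # q1)"
    using snoc.prems(1,2) by (auto simp: sorted_append)
      (metis order.not_eq_order_implies_strict sorted_append)+
  have crk: "card {x \<in> ?X. x < j} = length ?A"
    unfolding rk using snoc.prems(2) distinct_card[of "p @ a # q1"] by (simp add: Int_Un_distrib)
  define Y where "Y = ?X - {a, j}"
  have X: "?X = insert a (insert j Y)" "?X - {j} = insert a Y" and Y: "a \<notin> Y" "j \<notin> Y" "finite Y"
    using snoc.prems(2) by (auto simp: Y_def)
  have rem: "remove1 j ?r = p @ a # q1 @ q2"
    using snoc.prems(2) by (simp add: remove1_append)
  have red: "map (\<lambda>x. if fst x = j then (a, True) else x) (?A @ ?B) =
     tails (remove1 j ?r) @ heads (map (\<lambda>x. if x = j then a else x) c)"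
    using snoc.prems(2) rem by (simp add: redirect_tails redirect_heads')
  have "matching_weight (insert a (insert j Y)) (?A @ (a, True) # (j, False) # ?B) =
    matching_weight (insert a (insert j Y)) (?A @ (j, False) # (a, True) # ?B) +
    (if even (length ?A) then (if False then 1 else -1) *
      matching_weight (insert a Y) (map (\<lambda>x. if fst x = j then (a, True) else x) (?A @ ?B)) else 0)"
    by (rule matching_weight_exchange) (use snoc.prems(2) Y in \<open>auto simp: in_set_tails in_set_heads\<close>)
  then have "matching_weight ?X (?A @ (j, False) # (a, True) # ?B) = matching_weight ?X (?A @ (a, True) # (j, False) # ?B) +
    (if even (length ?A) then ?T j else 0)"
    unfolding red X(1)[symmetric] X(2)[symmetric] by simp
  also have "matching_weight ?X (?A @ (a, True) # (j, False) # ?B) =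
    (if even (length p) then matching_weight (?X - {a}) (tails (p @ (q1 @ [j]) @ q2) @ heads c) else 0) +
    (\<Sum>j | j \<in> set q1 \<and> even (card {x \<in> ?X. x < j}). ?T j)"
    using snoc.IH[of "j # q2"] snoc.prems by simp
  also have "\<dots> + (if even (length ?A) then ?T j else 0) =
     (if even (length p) then matching_weight (?X - {a}) (tails (p @ (q1 @ [j]) @ q2) @ heads c) else 0) +
     (\<Sum>k | k \<in> insert j (set q1) \<and> even (card {x \<in> ?X. x < k}). ?T k)"
  proof -
    have nj: "j \<notin> set q1" using snoc.prems(2) by simp
    have e: "(\<Sum>k | k \<in> insert j (set q1) \<and> even (card {x \<in> ?X. x < k}). ?T k) =
       (\<Sum>j | j \<in> set q1 \<and> even (card {x \<in> ?X. x < j}). ?T j) +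
       (if even (length ?A) then ?T j else 0)"
      using sum_filter_insert[OF nj finite_set, where T = ?T and P = "\<lambda>j. even (card {x \<in> ?X. x < j})"]
      unfolding crk .
    show ?thesis unfolding e by (rule add.assoc)
  qed
  finally show ?case by simp
qed

text \<open>
  The diagram of a word: rows (tails) in increasing order on the left boundary, then columns (heads) on
  the top boundary.
\<close>

definition diagram_weight :: "nat list \<Rightarrow> int" where
  "diagram_weight w = matching_weight (set w) (tails (sorted_list_of_set (set w)) @ heads w)"

lemma diagram_weight_Nil: "diagram_weight [] = 1"
  by (simp add: diagram_weight_def matching_weight_def word_weight_Nil)

text \<open>
  The recursion of the column process: the first letter \<open>a\<close> is exchanged with a letter \<open>j \<ge> a\<close>
  that has an even number of smaller letters, and then removed.
\<close>

lemma diagram_weight_Cons: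
  assumes "distinct (a # c)"
  shows "diagram_weight (a # c) = (\<Sum>j | j \<in> set (a # c) \<and> a \<le> j \<and> even (card {x \<in> set (a # c). x < j}).
           diagram_weight (map (\<lambda>x. if x = j then a else x) c))"
proof -
  let ?X = "set (a # c)"
  define r where "r = sorted_list_of_set ?X"
  have sr: "set r = ?X" unfolding r_def by (simp only: set_sorted_list_of_set finite_set)
  then have "a \<in> set r" by simp
  then obtain p q where pq: "r = p @ a # q" by (meson split_list)
  have r: "sorted (p @ a # q)" "distinct (p @ a # q)" "set (p @ a # q) = ?X"
    unfolding pq[symmetric] sr unfolding r_def
    by (rule sorted_sorted_list_of_set, rule distinct_sorted_list_of_set, rule refl)
  have c: "set c = set (p @ q)" using r(2,3) assms by auto
  have rk: "{x \<in> ?X. x < a} = set p"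
    unfolding r(3)[symmetric] using r(1,2) by (auto simp: sorted_append)
      (metis order.not_eq_order_implies_strict)
  then have crk: "card {x \<in> ?X. x < a} = length p" using r(2) by (simp add: distinct_card)
  have T: "matching_weight (?X - {j}) (tails (remove1 j r) @ heads (map (\<lambda>x. if x = j then a else x) c)) =
      diagram_weight (map (\<lambda>x. if x = j then a else x) c)" if "j \<in> ?X" for j
  proof -
    have "set (map (\<lambda>x. if x = j then a else x) c) = ?X - {j}"
      using assms that by auto
    then show ?thesis unfolding diagram_weight_def r_def
      by (simp add: sorted_list_of_set_remove)
  qed
  let ?T = "\<lambda>j. diagram_weight (map (\<lambda>x. if x = j then a else x) c)"
  have ca: "map (\<lambda>x. if x = a then a else x) c = c" by (simp add: map_idI)
  have "diagram_weight (a # c) = matching_weight ?X (tails (p @ a # q) @ (a, True) # tails [] @ heads c)"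
    unfolding diagram_weight_def r_def[symmetric] pq by simp
  also have "\<dots> = (if even (length p) then matching_weight (?X - {a}) (tails (p @ q) @ heads c) else 0) +
    (\<Sum>j | j \<in> set q \<and> even (card {x \<in> ?X. x < j}). matching_weight (?X - {j})
       (tails (remove1 j r) @ heads (map (\<lambda>x. if x = j then a else x) c)))"
    using matching_weight_column_aux[of p a q "[]" c] r c by (simp add: pq)
  also have "matching_weight (?X - {a}) (tails (p @ q) @ heads c) = ?T a"
    using T[of a] r(2) by (simp add: ca pq remove1_append)
  also have "(\<Sum>j | j \<in> set q \<and> even (card {x \<in> ?X. x < j}). matching_weight (?X - {j})
       (tails (remove1 j r) @ heads (map (\<lambda>x. if x = j then a else x) c))) =
     (\<Sum>j | j \<in> set q \<and> even (card {x \<in> ?X. x < j}). ?T j)"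
    using T r(3) by (intro sum.cong) auto
  also have "(if even (length p) then ?T a else 0) + \<dots> =
     (\<Sum>j | j \<in> ?X \<and> a \<le> j \<and> even (card {x \<in> ?X. x < j}). ?T j)"
  proof -
    define R where "R j = card {x \<in> ?X. x < j}" for j
    have "j \<in> ?X \<and> a \<le> j \<longleftrightarrow> j = a \<or> j \<in> set q" for j
      unfolding r(3)[symmetric] using r(1,2) by (auto simp: sorted_append)
    then have "{j. j \<in> ?X \<and> a \<le> j \<and> even (R j)} = {j. (j = a \<or> j \<in> set q) \<and> even (R j)}"
      by (metis (no_types, lifting))
    moreover have "a \<notin> set q" using r(2) by auto
    moreover have "R a = length p" using crk by (simp add: R_def)
    ultimately show ?thesis
      using sum_filter_insert[of a "set q" ?T "\<lambda>j. even (R j)"]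
      unfolding R_def[symmetric] by simp
  qed
  finally show ?thesis .
qed

text \<open>
  A chord whose tail is the first point and which spans the first \<open>L\<close> points of \<open>W\<close>.
\<close>

definition insert_chord :: "nat \<Rightarrow> token list \<Rightarrow> nat \<Rightarrow> token list" where
  "insert_chord z W L = (z, False) # take L W @ (z, True) # drop L W"

definition parallel :: "nat list \<Rightarrow> token list" where
  "parallel l = tails l @ heads l"

definition chord_weight :: "nat \<Rightarrow> nat \<Rightarrow> int" where
  "chord_weight M L = matching_weight {..M} (insert_chord 0 (parallel [1..<Suc M]) L)"

text \<open>
  Only the shape of the matching matters, not the letters that name its chords.
\<close>

lemma matching_weight_chord:
  assumes "distinct (z # l)"
  shows "matching_weight (insert z (set l)) (insert_chord z (parallel l) L) = chord_weight (length l) L"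
proof -
  define f where "f i = (z # l) ! i" for i
  have inj: "inj_on f {..length l}"
    using assms unfolding f_def inj_on_def by (auto simp: nth_eq_iff_index_eq simp del: distinct.simps)
  have l: "map f [1..<Suc (length l)] = l"
  proof -
    have "[1..<Suc (length l)] = map Suc [0..<length l]"
      by (simp add: map_Suc_upt del: upt_Suc)
    then show ?thesis by (simp add: f_def comp_def map_nth del: upt_Suc)
  qed
  have im: "f ` {..length l} = insert z (set l)"
  proof -
    have "{..length l} = insert 0 (set [1..<Suc (length l)])" by auto
    then have "f ` {..length l} = insert (f 0) (set (map f [1..<Suc (length l)]))"
      by (metis image_insert set_map)
    then show ?thesis by (simp only: l) (simp add: f_def)
  qed
  have mp: "map (map_prod f id) (parallel k) = parallel (map f k)" for k
    by (simp add: parallel_def tails_def heads_def)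
  have "map (map_prod f id) (insert_chord 0 (parallel [1..<Suc (length l)]) L) =
     insert_chord (f 0) (parallel (map f [1..<Suc (length l)])) L"
    by (simp only: insert_chord_def mp[symmetric] take_map drop_map) simp
  then have "map (map_prod f id) (insert_chord 0 (parallel [1..<Suc (length l)]) L) =
     insert_chord z (parallel l) L" by (simp only: l) (simp add: f_def)
  moreover have "fst ` set (insert_chord 0 (parallel [1..<Suc (length l)]) L) \<subseteq> {..length l}"
    by (auto simp: insert_chord_def parallel_def dest!: in_set_takeD in_set_dropD)
      (auto simp: in_set_tails in_set_heads)
  ultimately show ?thesis
    using matching_weight_rename[OF inj, of "insert_chord 0 (parallel [1..<Suc (length l)]) L"] im
    unfolding chord_weight_def by simp
qed

text \<open>
  When the head of \<open>z\<close> passes the tail of the parallel chord \<open>j\<close>, the reduced matching joins \<open>z\<close> to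
  the head of \<open>j\<close>.  The length of \<open>l1\<close> is odd exactly if the position of the exchange is even,
  since the tail of \<open>z\<close> precedes \<open>l1\<close>.
\<close>

lemma matching_weight_chord_step_tail:
  fixes l1 l2 :: "nat list"
  assumes "distinct (z # l1 @ j # l2)"
  defines "l \<equiv> l1 @ j # l2"
  shows "matching_weight (insert z (set l)) (insert_chord z (parallel l) (Suc (length l1))) =
    matching_weight (insert z (set l)) (insert_chord z (parallel l) (length l1)) +
    (if odd (length l1) then matching_weight (insert z (set (l1 @ l2)))
       (insert_chord z (parallel (l1 @ l2)) (length (l1 @ l2) + length l1)) else 0)"
proof -
  let ?A = "(z, False) # tails l1" and ?B = "tails l2 @ heads l"
  let ?X = "set (l1 @ l2)"
  have l: "insert z (set l) = insert z (insert j ?X)" by (auto simp: l_def)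
  have red: "map (\<lambda>x. if fst x = j then (z, True) else x) (?A @ ?B) =
      insert_chord z (parallel (l1 @ l2)) (length (l1 @ l2) + length l1)"
    using assms(1) by (simp add: l_def insert_chord_def parallel_def redirect_tails redirect_heads)
  have "matching_weight (insert z (insert j ?X)) (?A @ (z, True) # (j, False) # ?B) =
    matching_weight (insert z (insert j ?X)) (?A @ (j, False) # (z, True) # ?B) +
    (if even (length ?A) then (if False then 1 else -1) * matching_weight (insert z ?X)
      (map (\<lambda>x. if fst x = j then (z, True) else x) (?A @ ?B)) else 0)"
    by (rule matching_weight_exchange) (use assms(1) in \<open>auto simp: l_def in_set_tails in_set_heads\<close>)
  then show ?thesis
    unfolding red l by (simp add: insert_chord_def parallel_def l_def)
qed

lemma matching_weight_chord_step_head: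
  fixes l1 l2 :: "nat list"
  assumes "distinct (z # l1 @ j # l2)"
  defines "l \<equiv> l1 @ j # l2"
  shows "matching_weight (insert z (set l)) (insert_chord z (parallel l) (Suc (length l + length l1))) =
    matching_weight (insert z (set l)) (insert_chord z (parallel l) (length l + length l1)) -
    (if odd (length l + length l1) then matching_weight (insert z (set (l1 @ l2)))
       (insert_chord z (parallel (l1 @ l2)) (length l1)) else 0)"
proof -
  let ?A = "(z, False) # tails l @ heads l1" and ?B = "heads l2"
  let ?X = "set (l1 @ l2)"
  have l: "insert z (set l) = insert z (insert j ?X)" by (auto simp: l_def)
  have red: "map (\<lambda>x. if fst x = j then (z, True) else x) (?A @ ?B) =
      insert_chord z (parallel (l1 @ l2)) (length l1)"
    using assms(1) by (simp add: l_def insert_chord_def parallel_def redirect_tails redirect_heads)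
  have "matching_weight (insert z (insert j ?X)) (?A @ (z, True) # (j, True) # ?B) =
    matching_weight (insert z (insert j ?X)) (?A @ (j, True) # (z, True) # ?B) +
    (if even (length ?A) then (if True then 1 else -1) * matching_weight (insert z ?X)
      (map (\<lambda>x. if fst x = j then (z, True) else x) (?A @ ?B)) else 0)"
    by (rule matching_weight_exchange) (use assms(1) in \<open>auto simp: l_def in_set_tails in_set_heads\<close>)
  moreover have "even (length ?A) = odd (length l + length l1)" by simp
  ultimately show ?thesis
    unfolding red l by (simp add: insert_chord_def parallel_def l_def)
qed

lemma upt_split_at:
  assumes "L < M"
  obtains l1 j l2 where "[1..<Suc M] = l1 @ j # l2" "length l1 = L" "distinct (0 # l1 @ j # l2)"
    "length (l1 @ j # l2) = M" "length (l1 @ l2) = M - 1"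
proof -
  obtain l1 j l2 where l: "[1..<Suc M] = l1 @ j # l2" "length l1 = L"
    using id_take_nth_drop[of L "[1..<Suc M]"] assms
    by (metis length_take length_upt diff_Suc_1 min.absorb2 less_imp_le_nat One_nat_def)
  moreover have "length (l1 @ j # l2) = M" unfolding l(1)[symmetric] by simp
  moreover have "distinct (0 # l1 @ j # l2)" unfolding l(1)[symmetric] by simp
  ultimately show ?thesis using that by simp
qed

lemma chord_weight_step_tail:
  assumes "L < M"
  shows "chord_weight M (Suc L) = chord_weight M L + (if odd L then chord_weight (M - 1) (M - 1 + L) else 0)"
proof -
  obtain l1 l2 :: "nat list" and j where l: "length l1 = L" "distinct (0 # l1 @ j # l2)"
    "length (l1 @ j # l2) = M" "length (l1 @ l2) = M - 1"
    using upt_split_at[OF assms] by blast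
  from l(2) have "distinct (0 # l1 @ l2)" by simp
  then show ?thesis
    using matching_weight_chord_step_tail[OF l(2)] matching_weight_chord[OF l(2)] matching_weight_chord[of 0 "l1 @ l2"] l(1)
    unfolding l(3,4) by metis
qed

lemma chord_weight_step_head:
  assumes "i < M"
  shows "chord_weight M (Suc (M + i)) = chord_weight M (M + i) - (if odd (M + i) then chord_weight (M - 1) i else 0)"
proof -
  obtain l1 l2 :: "nat list" and j where l: "length l1 = i" "distinct (0 # l1 @ j # l2)"
    "length (l1 @ j # l2) = M" "length (l1 @ l2) = M - 1"
    using upt_split_at[OF assms] by blast
  from l(2) have "distinct (0 # l1 @ l2)" by simp
  then show ?thesis
    using matching_weight_chord_step_head[OF l(2)] matching_weight_chord[OF l(2)] matching_weight_chord[of 0 "l1 @ l2"] l(1)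
    unfolding l(3,4) by metis
qed

lemma matching_weight_parallel:
  assumes "distinct l" "l \<noteq> []"
  shows "matching_weight (set l) (parallel l) = chord_weight (length l - 1) (length l - 1)"
proof -
  from assms obtain z k where l: "l = z # k" by (cases l) auto
  then show ?thesis using matching_weight_chord[of z k "length k"] assms
    by (simp add: insert_chord_def parallel_def)
qed

lemma chord_weight_0: "chord_weight M 0 = (if M = 0 then 1 else chord_weight (M - 1) (M - 1))"
proof -
  have "{..M} = insert 0 (set [1..<Suc M])" by auto
  moreover have "insert_chord 0 (parallel [1..<Suc M]) 0 =
     [] @ (0, False) # (0, True) # parallel [1..<Suc M]"
    by (simp add: insert_chord_def)
  ultimately have "chord_weight M 0 = matching_weight (set [1..<Suc M]) (parallel [1..<Suc M])"
    unfolding chord_weight_def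
    using matching_weight_arc[of "set [1..<Suc M]" 0 "[]" "parallel [1..<Suc M]"]
    by (simp add: image_Un parallel_def)
  then show ?thesis
    using matching_weight_parallel[of "[1..<Suc M]"] by (auto simp: matching_weight_def parallel_def word_weight_Nil)
qed

lemma diagram_weight_insert_min:
  assumes "sorted (z # u @ v)" "distinct (z # u @ v)"
  shows "diagram_weight (u @ z # v) = chord_weight (length (u @ v)) (length (u @ v) + length u)"
proof -
  have "set (u @ z # v) = set (z # u @ v)" by auto
  then have "sorted_list_of_set (set (u @ z # v)) = z # u @ v"
    using sorted_list_of_set.idem_if_sorted_distinct[OF assms] by (simp only:)
  moreover have "insert_chord z (parallel (u @ v)) (length (u @ v) + length u) =
      (z, False) # tails (u @ v) @ heads (u @ z # v)"
    by (simp add: insert_chord_def parallel_def)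
  moreover have "set (u @ z # v) = insert z (set (u @ v))" by auto
  ultimately show ?thesis
    using matching_weight_chord[of z "u @ v" "length (u @ v) + length u"] assms(2)
    by (simp add: diagram_weight_def)
qed

section \<open>Recurrences and the Seidel triangle\<close>

lemma chord_weight_even_step:
  assumes "even L" "L < 2 * M"
  shows "chord_weight M (Suc L) = chord_weight M L"
proof (cases "L < M")
  case True
  then show ?thesis using chord_weight_step_tail assms by simp
next
  case False
  then obtain i where "L = M + i" using le_Suc_ex by (metis not_less)
  then show ?thesis using chord_weight_step_head[of i M] assms by auto
qed

text \<open>
  Under the symmetry, the values at \<open>2 * M - 1\<close> and at 1 agree; the latter is the value at 0, and the last
  step from \<open>2 * M - 1\<close> to \<open>2 * M\<close> subtracts just this number.
\<close>

lemma chord_weight_full: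
  assumes "M > 0" and sym: "\<And>L. odd L \<Longrightarrow> L < 2 * M \<Longrightarrow> chord_weight M L = chord_weight M (2 * M - L)"
  shows "chord_weight M (2 * M) = 0"
proof -
  have "Suc (M + (M - 1)) = 2 * M" "M + (M - 1) = 2 * M - 1" using assms(1) by auto
  then have "chord_weight M (2 * M) = chord_weight M (2 * M - 1) - chord_weight (M - 1) (M - 1)"
    using chord_weight_step_head[of "M - 1" M] assms(1) by auto
  moreover have "chord_weight M (2 * M - 1) = chord_weight M 1" using sym[of 1] assms(1) by simp
  moreover have "chord_weight M 1 = chord_weight M 0" using chord_weight_even_step[of 0 M] assms(1) by simp
  ultimately show ?thesis using chord_weight_0[of M] assms(1) by simp
qed

text \<open>
  Reflection of the diagram, proved from the recurrences: starting from the middle, steps to the left and to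
  the right change the value by amounts that are equal by the symmetry for \<open>M - 1\<close>.
\<close>

lemma chord_weight_symmetric:
  "odd L \<Longrightarrow> L < 2 * M \<Longrightarrow> chord_weight M L = chord_weight M (2 * M - L)"
proof (induction M arbitrary: L)
  case 0
  then show ?case by simp
next
  case (Suc N)
  define M where "M = Suc N"
  note IH = Suc.IH
  have low: "chord_weight M L = chord_weight M (2 * M - L)" if "L + d = M" "odd L" for L d
    using that
  proof (induction d arbitrary: L rule: less_induct)
    case (less d)
    consider "d = 0" | "d = 1" | "d \<ge> 2" by linarith
    then show ?case
    proof cases
      case 1
      then show ?thesis using less.prems by (simp add: mult_2)
    next
      case 2
      then have L: "L = N" "N > 0" "odd N" using less.prems by (auto simp: M_def odd_pos)
      have "chord_weight M (Suc M) = chord_weight M M" using chord_weight_even_step[of M M] L by (simp add: M_def)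
      moreover have "chord_weight M (Suc N) = chord_weight M N + chord_weight N (N + N)"
        using chord_weight_step_tail[of N M] L by (simp add: M_def)
      moreover have "chord_weight N (2 * N) = 0" using chord_weight_full[of N] IH L by blast
      moreover have "2 * M - L = Suc M" using L by (simp add: M_def)
      ultimately show ?thesis using L by (simp add: M_def mult_2)
    next
      case 3
      then have LN: "L < N" "L + 2 \<le> M" using less.prems by (auto simp: M_def)
      define i where "i = N - L - 1"
      have up: "chord_weight M (Suc (Suc L)) = chord_weight M L + chord_weight N (N + L)"
        using chord_weight_even_step[of "Suc L" M] chord_weight_step_tail[of L M] LN less.prems by (simp add: M_def)
      have oi: "odd (M + i)" "i < M" "Suc (Suc (M + i)) = 2 * M - L" "M + i = 2 * M - Suc (Suc L)"
        using LN less.prems by (auto simp: M_def i_def)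
      have down: "chord_weight M (2 * M - L) = chord_weight M (M + i) - chord_weight N i"
        using chord_weight_even_step[of "Suc (M + i)" M] chord_weight_step_head[of i M] oi LN by (simp add: M_def)
      have mid: "chord_weight M (Suc (Suc L)) = chord_weight M (M + i)"
        using less.IH[of "d - 2" "Suc (Suc L)"] 3 less.prems oi(4) by simp
      \<comment> \<open>The two lengths add up to \<open>2 * N - 1\<close>; raising the even one by 1 keeps the value and makes
        the symmetry for \<open>N\<close> applicable.\<close>
      have "chord_weight N (N + L) = chord_weight N i"
      proof (cases "odd (N + L)")
        case True
        then have "even i" "i < 2 * N" "Suc i = N - L" "odd (N - L)"
          using LN by (auto simp: i_def)
        then have "chord_weight N i = chord_weight N (N - L)" using chord_weight_even_step[of i N] by simp
        also have "\<dots> = chord_weight N (2 * N - (N - L))"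
          using IH[of "N - L"] LN \<open>odd (N - L)\<close> by simp
        also have "2 * N - (N - L) = N + L" using LN by simp
        finally show ?thesis by simp
      next
        case False
        then have "Suc L < N" using LN(1) by (cases "Suc L = N") auto
        then have "chord_weight N (N + L) = chord_weight N (Suc (N + L))" using chord_weight_even_step[of "N + L" N] False by simp
        also have "\<dots> = chord_weight N (2 * N - Suc (N + L))" using IH[of "Suc (N + L)"] False \<open>Suc L < N\<close> by simp
        also have "2 * N - Suc (N + L) = i" using LN by (simp add: i_def)
        finally show ?thesis .
      qed
      then show ?thesis using up down mid by simp
    qed
  qed
  show ?case
  proof (cases "L \<le> M")
    case True
    then show ?thesis using low[of L "M - L"] Suc.prems by (simp add: M_def)
  next
    case False
    then show ?thesis
      using low[of "2 * M - L" "L - M"] Suc.prems by (simp add: M_def)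
  qed
qed

lemma seidel_even_row:
  assumes n: "n \<ge> 1" and odd_row: "\<And>m. 1 \<le> m \<Longrightarrow> m \<le> n \<Longrightarrow> int (seidel (2 * n - 1) m) = chord_weight (2 * n - 2) (2 * m - 2)"
    and k: "1 \<le> k" "k \<le> n + 1"
  shows "int (seidel (2 * n) k) = chord_weight (2 * n - 1) (2 * n + 2 * k - 4)"
  using k(2,1)
proof (induction k rule: inc_induct)
  case base
  have "chord_weight (2 * n - 1) (2 * (2 * n - 1)) = 0"
    using n by (intro chord_weight_full chord_weight_symmetric) auto
  moreover have "2 * (2 * n - 1) = 2 * n + 2 * (n + 1) - 4" using n by simp
  ultimately show ?case by (simp add: seidel_outside)
next
  case (step k)
  have k: "1 \<le> k" "k \<le> n" using step by auto
  let ?L = "2 * n + 2 * k - 4"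
  have L: "Suc (Suc ?L) = 2 * n + 2 * Suc k - 4" "Suc ?L = (2 * n - 1) + (2 * k - 2)" "even ?L"
    using k n by auto
  have "int (seidel (2 * n) k) = chord_weight (2 * n - 1) (Suc (Suc ?L)) + chord_weight (2 * n - 2) (2 * k - 2)"
    using seidel_even[of n k] odd_row[of k] step.IH L(1) n k by simp
  also have "chord_weight (2 * n - 1) (Suc (Suc ?L)) = chord_weight (2 * n - 1) (Suc ?L) - chord_weight (2 * n - 2) (2 * k - 2)"
  proof -
    have "odd (2 * n - 1 + (2 * k - 2))" "2 * k - 2 < 2 * n - 1" "2 * n - 1 - 1 = 2 * n - 2"
      using k n by auto
    then show ?thesis unfolding L(2) using chord_weight_step_head[of "2 * k - 2" "2 * n - 1"] by presburger
  qed
  also have "chord_weight (2 * n - 1) (Suc ?L) = chord_weight (2 * n - 1) ?L"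
    using k n by (intro chord_weight_even_step) auto
  finally show ?case by simp
qed

lemma seidel_odd_row:
  assumes n: "n \<ge> 1" and even_row: "\<And>k. 1 \<le> k \<Longrightarrow> k \<le> n + 1 \<Longrightarrow> int (seidel (2 * n) k) = chord_weight (2 * n - 1) (2 * n + 2 * k - 4)"
    and m: "1 \<le> m" "m \<le> n + 1"
  shows "int (seidel (2 * n + 1) m) = chord_weight (2 * n) (2 * m - 2)"
  using m
proof (induction m rule: dec_induct)
  case base
  have "int (seidel (2 * n + 1) 1) = chord_weight (2 * n - 1) (2 * n - 2)"
    using seidel_odd[of n 1] even_row[of 1] n by (simp add: seidel_outside)
  also have "\<dots> = chord_weight (2 * n - 1) (Suc (2 * n - 2))"
    using n by (intro chord_weight_even_step[symmetric]) auto
  also have "Suc (2 * n - 2) = 2 * n - 1" using n by simp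
  also have "chord_weight (2 * n - 1) (2 * n - 1) = chord_weight (2 * n) 0" using chord_weight_0[of "2 * n"] n by simp
  finally show ?case by simp
next
  case (step m)
  let ?L = "2 * m - 2"
  have L: "Suc ?L = 2 * m - 1" "Suc (2 * m - 1) = 2 * Suc m - 2" using step by auto
  have "int (seidel (2 * n + 1) (Suc m)) = chord_weight (2 * n) ?L + chord_weight (2 * n - 1) (2 * n + 2 * Suc m - 4)"
    using seidel_odd[of n "Suc m"] even_row[of "Suc m"] step n by simp
  also have "chord_weight (2 * n) ?L = chord_weight (2 * n) (2 * m - 1)"
    using chord_weight_even_step[of ?L "2 * n"] L step by simp
  also have "chord_weight (2 * n) (2 * m - 1) + chord_weight (2 * n - 1) (2 * n + 2 * Suc m - 4) = chord_weight (2 * n) (2 * Suc m - 2)"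
  proof -
    have e: "2 * n - 1 + (2 * m - 1) = 2 * n + 2 * Suc m - 4" "2 * m - 1 < 2 * n" "odd (2 * m - 1)"
      using step by auto
    show ?thesis
      using chord_weight_step_tail[OF e(2), unfolded if_P[OF e(3)], unfolded e(1) L(2)] by (rule sym)
  qed
  finally show ?case .
qed

text \<open>
  Odd rows of the triangle come from lengths \<open>L \<le> M\<close> with \<open>M\<close> even, even rows from lengths
  \<open>L \<ge> M - 1\<close> with \<open>M\<close> odd.  In both, moving the end of the chord by two points changes the value by
  an entry of the preceding row.
\<close>

lemma seidel_rows:
  assumes "n \<ge> 1"
  shows "(\<forall>m. 1 \<le> m \<and> m \<le> n \<longrightarrow> int (seidel (2 * n - 1) m) = chord_weight (2 * n - 2) (2 * m - 2)) \<and>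
    (\<forall>k. 1 \<le> k \<and> k \<le> n + 1 \<longrightarrow> int (seidel (2 * n) k) = chord_weight (2 * n - 1) (2 * n + 2 * k - 4))"
  using assms
proof (induction n rule: dec_induct)
  case base
  have "int (seidel (2 * 1 - 1) m) = chord_weight (2 * 1 - 2) (2 * m - 2)" if "1 \<le> m" "m \<le> 1" for m
    using that seidel_1_1 chord_weight_0[of 0] by auto
  then show ?case using seidel_even_row[of 1] by blast
next
  case (step n)
  have "int (seidel (2 * Suc n - 1) m) = chord_weight (2 * Suc n - 2) (2 * m - 2)" if "1 \<le> m" "m \<le> Suc n" for m
    using seidel_odd_row[of n m] step that by simp
  then show ?case using seidel_even_row[of "Suc n"] by simp
qed

section \<open>Counting web permutations\<close>

lemma column_process_permutes:
  assumes "column_process n t \<sigma> \<tau>" "1 \<le> t" "\<sigma> permutes {1..n}"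
  shows "\<tau> permutes {1..n}"
  using assms
proof (induction rule: column_process.induct)
  case (column_process_done \<sigma>)
  then show ?case by simp
next
  case (column_process_step t l \<sigma> \<tau>)
  then have "\<sigma> \<circ> Transposition.transpose t l permutes {1..n}"
    by (intro permutes_compose[OF permutes_swap_id]) auto
  then show ?case using column_process_step.IH by (simp del: o_apply One_nat_def)
qed

lemma column_process_prefix:
  assumes "column_process n t \<sigma> \<tau>" "m < t"
  shows "\<tau> m = \<sigma> m"
  using assms by (induction rule: column_process.induct) (auto simp: transpose_def)

lemma rows_from_column_process:
  assumes "column_process n t \<sigma> \<tau>" "1 \<le> t" "\<sigma> permutes {1..n}"
  shows "\<tau> ` {t..n} = \<sigma> ` {t..n}"
proof -
  have "\<pi> ` {t..n} = {1..n} - \<pi> ` {1..<t}" if "\<pi> permutes {1..n}" for \<pi>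
  proof (cases "t \<le> Suc n")
    case True
    have "{t..n} = {1..n} - {1..<t}" using assms(2) True by auto
    then show ?thesis
      using permutes_inj[OF that] permutes_image[OF that] by (metis image_set_diff)
  next
    case False
    then have "{1..n} \<subseteq> {1..<t}" by auto
    then have "{1..n} \<subseteq> \<pi> ` {1..<t}" using permutes_image[OF that] by blast
    then show ?thesis using False by simp
  qed
  from this[OF assms(3)] this[OF column_process_permutes[OF assms]]
  show ?thesis using column_process_prefix[OF assms(1)] by simp
qed

definition even_outcomes :: "nat \<Rightarrow> nat \<Rightarrow> (nat \<Rightarrow> nat) \<Rightarrow> (nat \<Rightarrow> nat) set" where
  "even_outcomes n t \<sigma> = {\<tau>. column_process n t \<sigma> \<tau> \<and> (\<forall>s\<in>{t..n}. even (lehmer n \<tau> s))}"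

lemma finite_even_outcomes:
  assumes "1 \<le> t" "\<sigma> permutes {1..n}"
  shows "finite (even_outcomes n t \<sigma>)"
  by (rule finite_subset[OF _ finite_permutations[of "{1..n}"]])
    (use column_process_permutes[OF _ assms] in \<open>auto simp: even_outcomes_def\<close>)

text \<open>
  The letter at position \<open>t\<close> is not touched after column \<open>t\<close>, and it determines the choice made
  there.
\<close>

lemma even_outcomes_step:
  assumes t: "1 \<le> t" "t \<le> n" and p: "\<sigma> permutes {1..n}"
    and l: "t \<le> l" "l \<le> n" "\<sigma> t \<le> \<sigma> l"
  shows "{\<tau> \<in> even_outcomes n t \<sigma>. \<tau> t = \<sigma> l} =
    (if even (card {x \<in> \<sigma> ` {t..n}. x < \<sigma> l})
     then even_outcomes n (Suc t) (\<sigma> \<circ> Transposition.transpose t l) else {})"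
proof -
  have first: "\<tau> t = \<sigma> m" if "column_process n (Suc t) (\<sigma> \<circ> Transposition.transpose t m) \<tau>" for \<tau> m
    using column_process_prefix[OF that, of t] by simp
  have col: "column_process n t \<sigma> \<tau> \<and> \<tau> t = \<sigma> l \<longleftrightarrow> column_process n (Suc t) (\<sigma> \<circ> Transposition.transpose t l) \<tau>" for \<tau>
    using column_process_iff[OF t(2), of \<sigma> \<tau>] first permutes_inj[OF p] l by (metis injD)
  have leh: "lehmer n \<tau> t = card {x \<in> \<sigma> ` {t..n}. x < \<sigma> l}" if "column_process n t \<sigma> \<tau>" "\<tau> t = \<sigma> l" for \<tau>
  proof -
    have "{m \<in> {1..n}. t \<le> m} = {t..n}" using t by auto
    then show ?thesis
      unfolding lehmer_def rows_from_image[OF column_process_permutes[OF that(1) t(1) p]]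
      using rows_from_column_process[OF that(1) t(1) p] that(2) by simp
  qed
  have split: "{t..n} = insert t {Suc t..n}" using t by auto
  define N where "N = card {x \<in> \<sigma> ` {t..n}. x < \<sigma> l}"
  have "\<tau> \<in> even_outcomes n t \<sigma> \<and> \<tau> t = \<sigma> l \<longleftrightarrow>
     even N \<and> \<tau> \<in> even_outcomes n (Suc t) (\<sigma> \<circ> Transposition.transpose t l)" for \<tau>
  proof (cases "column_process n (Suc t) (\<sigma> \<circ> Transposition.transpose t l) \<tau>")
    case True
    then have "column_process n t \<sigma> \<tau>" "\<tau> t = \<sigma> l" using col by blast+
    moreover from this have "lehmer n \<tau> t = N" using leh N_def by simp
    ultimately show ?thesis using True unfolding even_outcomes_def split by auto
  next
    case False
    then show ?thesis using col[of \<tau>] unfolding even_outcomes_def by blast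
  qed
  then show ?thesis unfolding N_def[symmetric] by auto
qed

lemma card_even_outcomes:
  assumes "1 \<le> t" "t \<le> Suc n" "\<sigma> permutes {1..n}"
  shows "int (card (even_outcomes n t \<sigma>)) = diagram_weight (map \<sigma> [t..<Suc n])"
  using assms(2,1,3)
proof (induction t arbitrary: \<sigma> rule: inc_induct)
  case base
  then show ?case by (simp add: even_outcomes_def column_process_Suc_iff diagram_weight_Nil)
next
  case (step t)
  then have t: "1 \<le> t" "t \<le> n" by auto
  note p = step.prems(2)
  have inj: "\<sigma> a = \<sigma> b \<longleftrightarrow> a = b" for a b using permutes_inj[OF p] by (auto dest: injD)
  let ?R = "\<lambda>l. even (card {x \<in> \<sigma> ` {t..n}. x < \<sigma> l})"
  let ?I = "{l. t \<le> l \<and> l \<le> n \<and> \<sigma> t \<le> \<sigma> l \<and> ?R l}"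
  have finI: "finite ?I" by (rule finite_subset[of _ "{..n}"]) auto
  have perm: "\<sigma> \<circ> Transposition.transpose t l permutes {1..n}" if "l \<in> ?I" for l
    using that t p by (simp add: permutes_compose permutes_swap_id)
  have "even_outcomes n t \<sigma> = (\<Union>l\<in>?I. even_outcomes n (Suc t) (\<sigma> \<circ> Transposition.transpose t l))"
  proof (intro equalityI subsetI)
    fix \<tau> assume \<tau>: "\<tau> \<in> even_outcomes n t \<sigma>"
    then obtain l where l: "t \<le> l" "l \<le> n" "\<sigma> t \<le> \<sigma> l"
      "column_process n (Suc t) (\<sigma> \<circ> Transposition.transpose t l) \<tau>"
      using column_process_iff[OF t(2)] by (auto simp: even_outcomes_def)
    have "\<tau> t = \<sigma> l" using column_process_prefix[OF l(4), of t] by simp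
    then have "\<tau> \<in> {\<tau> \<in> even_outcomes n t \<sigma>. \<tau> t = \<sigma> l}" using \<tau> by simp
    then show "\<tau> \<in> (\<Union>l\<in>?I. even_outcomes n (Suc t) (\<sigma> \<circ> Transposition.transpose t l))"
      unfolding even_outcomes_step[OF t p l(1-3)] using l by (auto split: if_splits)
  next
    fix \<tau> assume "\<tau> \<in> (\<Union>l\<in>?I. even_outcomes n (Suc t) (\<sigma> \<circ> Transposition.transpose t l))"
    then obtain l where l: "t \<le> l" "l \<le> n" "\<sigma> t \<le> \<sigma> l" "?R l"
      "\<tau> \<in> even_outcomes n (Suc t) (\<sigma> \<circ> Transposition.transpose t l)" by auto
    then show "\<tau> \<in> even_outcomes n t \<sigma>" using even_outcomes_step[OF t p l(1-3)] by auto
  qed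
  moreover have "even_outcomes n (Suc t) (\<sigma> \<circ> Transposition.transpose t l) \<inter>
      even_outcomes n (Suc t) (\<sigma> \<circ> Transposition.transpose t m) = {}"
    if "l \<noteq> m" for l m
  proof -
    have "\<tau> t = \<sigma> k" if "\<tau> \<in> even_outcomes n (Suc t) (\<sigma> \<circ> Transposition.transpose t k)" for \<tau> k
      using that column_process_prefix[of n "Suc t" _ \<tau> t] by (auto simp: even_outcomes_def)
    then show ?thesis using inj \<open>l \<noteq> m\<close> by (metis disjoint_iff)
  qed
  ultimately have "int (card (even_outcomes n t \<sigma>)) =
      (\<Sum>l\<in>?I. int (card (even_outcomes n (Suc t) (\<sigma> \<circ> Transposition.transpose t l))))"
    using finI perm finite_even_outcomes[of "Suc t"] by (simp add: card_UN_disjoint)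
  also have "\<dots> = (\<Sum>l\<in>?I. diagram_weight (map (\<sigma> \<circ> Transposition.transpose t l) [Suc t..<Suc n]))"
    using perm step.IH by (intro sum.cong) auto
  also have "\<dots> = (\<Sum>j\<in>\<sigma> ` ?I. diagram_weight (map (\<lambda>x. if x = j then \<sigma> t else x) (map \<sigma> [Suc t..<Suc n])))"
  proof (subst sum.reindex)
    show "inj_on \<sigma> ?I" using permutes_inj_on[OF p] .
    have "map (\<sigma> \<circ> Transposition.transpose t l) [Suc t..<Suc n] =
        map (\<lambda>x. if x = \<sigma> l then \<sigma> t else x) (map \<sigma> [Suc t..<Suc n])" for l
      by (auto simp: inj transpose_def simp del: upt_Suc)
    then show "(\<Sum>l\<in>?I. diagram_weight (map (\<sigma> \<circ> Transposition.transpose t l) [Suc t..<Suc n])) =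
      sum ((\<lambda>j. diagram_weight (map (\<lambda>x. if x = j then \<sigma> t else x) (map \<sigma> [Suc t..<Suc n]))) \<circ> \<sigma>) ?I"
      by (intro sum.cong refl) (simp only: o_apply)
  qed
  also have "\<dots> = diagram_weight (\<sigma> t # map \<sigma> [Suc t..<Suc n])"
  proof -
    have d: "distinct (\<sigma> t # map \<sigma> [Suc t..<Suc n])"
      using permutes_inj_on[OF p] by (auto simp: distinct_map inj simp del: upt_Suc)
    have s: "set (\<sigma> t # map \<sigma> [Suc t..<Suc n]) = \<sigma> ` {t..n}"
    proof -
      have "{t..n} = insert t {Suc t..<Suc n}" using t by auto
      then show ?thesis by (simp del: upt_Suc)
    qed
    have "{j. j \<in> \<sigma> ` {t..n} \<and> \<sigma> t \<le> j \<and> even (card {x \<in> \<sigma> ` {t..n}. x < j})} = \<sigma> ` ?I"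
      by auto
    then show ?thesis unfolding diagram_weight_Cons[OF d] s by simp
  qed
  also have "\<sigma> t # map \<sigma> [Suc t..<Suc n] = map \<sigma> [t..<Suc n]"
    using t by (simp add: upt_conv_Cons del: upt_Suc)
  finally show ?case .
qed

lemma web_count_eq_diagram_weight:
  assumes "odd k" "k \<le> n"
  shows "int (web_count n k) = diagram_weight (map (Transposition.transpose 1 k) [2..<Suc n])"
proof -
  have k: "1 \<le> k" "1 \<le> n" using odd_pos[OF assms(1)] assms(2) by simp_all
  have "web_permutation n \<sigma> \<and> matching n \<sigma> = matching0 n \<longleftrightarrow> \<sigma> \<in> even_outcomes n 1 id" for \<sigma>
    using column_process_permutes[of n 1 id \<sigma>] matching0_iff_even_lehmer[of \<sigma> n]
    by (auto simp: web_permutation_iff_column_process even_outcomes_def permutes_id)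
  then have "{\<sigma>. web_permutation n \<sigma> \<and> matching n \<sigma> = matching0 n \<and> \<sigma> 1 = k} =
      {\<sigma> \<in> even_outcomes n 1 id. \<sigma> 1 = id k}" by auto
  also have "\<dots> = even_outcomes n 2 (Transposition.transpose 1 k)"
  proof -
    have "{x \<in> {1..n}. x < k} = {1..<k}" using assms by auto
    moreover have "even (k - Suc 0)" using assms(1) by (cases k) auto
    ultimately show ?thesis
      using even_outcomes_step[of 1 n id k] assms k permutes_id by (simp add: numeral_2_eq_2)
  qed
  finally show ?thesis
    unfolding web_count_def
    using card_even_outcomes[of 2 n "Transposition.transpose 1 k"] assms k permutes_swap_id[of 1 "{1..n}" k]
    by simp
qed

text \<open>
  Choosing the letter \<open>k > 1\<close> in the first column puts the letter 1 at position \<open>k\<close>; the remaining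
  letters increase, so that 1 is the additional chord.  For \<open>k = 1\<close> the remaining word is increasing,
  and its first letter 2 takes this role.
\<close>

lemma web_count_eq_chord_weight:
  assumes "odd k" "k \<le> n" "2 \<le> n"
  shows "int (web_count n k) = (if k = 1 then chord_weight (n - 2) (n - 2) else chord_weight (n - 2) (n - 2 + (k - 2)))"
proof (cases "k = 1")
  case True
  have "[2..<Suc n] = [] @ 2 # [3..<Suc n]"
    using assms(3) by (simp add: upt_conv_Cons numeral_3_eq_3 del: upt_Suc)
  then show ?thesis
    using True web_count_eq_diagram_weight[OF assms(1,2)] diagram_weight_insert_min[of 2 "[]" "[3..<Suc n]"]
    by (simp del: upt_Suc)
next
  case False
  then have k: "2 \<le> k" using odd_pos[OF assms(1)] by linarith
  have "[2..<Suc n] = [2..<k] @ k # [Suc k..<Suc n]"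
    using k assms(2) upt_add_eq_append[of 2 k "Suc n - k"] upt_conv_Cons[of k "Suc n"] by simp
  moreover have "map (Transposition.transpose 1 k) [2..<k] = [2..<k]"
    "map (Transposition.transpose 1 k) [Suc k..<Suc n] = [Suc k..<Suc n]"
    using k by (auto intro!: map_idI simp: transpose_def simp del: upt_Suc)
  ultimately have "map (Transposition.transpose 1 k) [2..<Suc n] = [2..<k] @ 1 # [Suc k..<Suc n]"
    by simp
  moreover have "sorted (1 # [2..<k] @ [Suc k..<Suc n])" "distinct (1 # [2..<k] @ [Suc k..<Suc n])"
    using k by (auto simp: sorted_append simp del: upt_Suc)
  ultimately show ?thesis
    using web_count_eq_diagram_weight[OF assms(1,2)] diagram_weight_insert_min[of 1 "[2..<k]" "[Suc k..<Suc n]"] False k assms(2)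
    by (simp del: upt_Suc)
qed

theorem mainTheorem1:
  shows "(\<forall>n k :: nat. 2 \<le> n \<and> 1 \<le> k \<and> k \<le> n \<longrightarrow>
            web_count (2 * n - 1) (2 * k - 1) = seidel (2 * n - 2) k) \<and>
         (\<forall>n k :: nat. 1 \<le> n \<and> 1 \<le> k \<and> k \<le> n \<longrightarrow>
            web_count (2 * n) (2 * k - 1) = seidel (2 * n - 1) (n - k + 1))"
proof (intro conjI allI impI; elim conjE)
  fix n k :: nat assume n: "2 \<le> n" and k: "1 \<le> k" "k \<le> n"
  define m where "m = n - 1"
  have m: "n = Suc m" "1 \<le> m" using n by (auto simp: m_def)
  have "int (web_count (2 * n - 1) (2 * k - 1)) =
      (if k = 1 then chord_weight (2 * m - 1) (2 * m - 1) else chord_weight (2 * m - 1) (2 * m + 2 * k - 4))"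
  proof -
    have e: "2 * n - 1 - 2 = 2 * m - 1" "2 * k - 1 = 1 \<longleftrightarrow> k = 1" using k m by auto
    have s: "2 * m - 1 + (2 * k - 1 - 2) = 2 * m + 2 * k - 4" if "k \<noteq> 1"
      using that k m by auto
    have "int (web_count (2 * n - 1) (2 * k - 1)) = (if 2 * k - 1 = 1 then chord_weight (2 * n - 1 - 2) (2 * n - 1 - 2)
        else chord_weight (2 * n - 1 - 2) (2 * n - 1 - 2 + (2 * k - 1 - 2)))"
      by (rule web_count_eq_chord_weight) (use k m in auto)
    then show ?thesis unfolding e
      by (cases "k = 1") (simp_all only: s if_True if_False simp_thms)
  qed
  also have "\<dots> = chord_weight (2 * m - 1) (2 * m + 2 * k - 4)"
  proof -
    have "even (2 * m - 2)" "2 * m - 2 < 2 * (2 * m - 1)" "2 * m - 1 = Suc (2 * m - 2)"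
      "2 * m + 2 * 1 - 4 = 2 * m - 2"
      using m by auto
    then show ?thesis using chord_weight_even_step[of "2 * m - 2" "2 * m - 1"] by metis
  qed
  also have "\<dots> = int (seidel (2 * m) k)"
    using seidel_rows[OF m(2)] k m by simp
  finally show "web_count (2 * n - 1) (2 * k - 1) = seidel (2 * n - 2) k"
    using m by simp
next
  fix n k :: nat assume n: "1 \<le> n" and k: "1 \<le> k" "k \<le> n"
  let ?M = "2 * n - 2"
  have "int (web_count (2 * n) (2 * k - 1)) = chord_weight ?M (2 * (n - k))"
  proof (cases "k = 1")
    case True
    then show ?thesis using web_count_eq_chord_weight[of 1 "2 * n"] n by (simp add: diff_mult_distrib2)
  next
    case False
    define L where "L = ?M + (2 * k - 3)"
    have L: "odd L" "L < 2 * ?M" "2 * ?M - L = Suc (2 * (n - k))" "2 * (n - k) < 2 * ?M"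
      using False k by (auto simp: L_def)
    have "int (web_count (2 * n) (2 * k - 1)) = chord_weight ?M L"
    proof -
      have e: "2 * n - 2 + (2 * k - 1 - 2) = L" "2 * k - 1 = 1 \<longleftrightarrow> False"
        using False k by (auto simp: L_def)
      have "int (web_count (2 * n) (2 * k - 1)) = (if 2 * k - 1 = 1 then chord_weight (2 * n - 2) (2 * n - 2)
          else chord_weight (2 * n - 2) (2 * n - 2 + (2 * k - 1 - 2)))"
        by (rule web_count_eq_chord_weight) (use k n in auto)
      then show ?thesis unfolding e by simp
    qed
    also have "\<dots> = chord_weight ?M (2 * (n - k))"
      using chord_weight_symmetric[OF L(1,2)] chord_weight_even_step[OF _ L(4)] L(3) by simp
    finally show ?thesis .
  qed
  also have "\<dots> = int (seidel (2 * n - 1) (n - k + 1))"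
    using seidel_rows[OF n] k by simp
  finally show "web_count (2 * n) (2 * k - 1) = seidel (2 * n - 1) (n - k + 1)" by simp
qed

end
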